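(* Suppose $\lim_{\eta\uparrow\infty}\epsilon_\eta\tau_\eta=\infty$ and $\lambda^\star_\eta=\mu^\star-d/\tau_\eta$ for some $d\in\mathbb{R}$. Suppose the following conditions hold. (Negative Drift) There exist $\delta,K,B>0$ such that $\phi^c(x)-\phi^s(x)<-\delta$ and $[\phi^c(x)]^++[\phi^s(x)]^-\le B$ for all $x>K$, and $\phi^c(x)-\phi^s(x)>\delta$ and $[\phi^c(x)]^-+[\phi^s(x)]^+\le B$ for all $x<-K$. (sub-Quadratic Growth) There exists $\beta\in(0,2)$ such that $|\phi^c(x)|\le|x|^\beta$ and $|\phi^s(x)|\le|x|^\beta$ for all $x\in\mathbb{R}$. ($\pm$ Jumps) With $K$ as in the Negative Drift condition, there exists $p_{\min}>0$ such that for all $\eta>0$ and all $z\in\mathbb{Z}$ with $|z|\le K\max\{\tau_\eta,1/\epsilon_\eta\}$: $P(a^c_\eta(z)>a^s_\eta(z))\ge p_{\min}$ and $P(a^c_\eta(z)<a^s_\eta(z))\ge p_{\min}$. (Monotonicity) $\phi^c$ is non-increasing and $\phi^s$ is non-decreasing; the set $\Phi^\star=\{x\in\mathbb{R}:\phi^c(x)-\phi^s(x)=0\}$ contains $0$; and $\phi^c(x)=\phi^s(x)=0$ for all $x\in\Phi^\star$. Let $\eta_0>0$ be such that $\tau_\eta\epsilon_\eta\ge2d/\delta$ for all $\eta\ge\eta_0$, let $\eta_p>0$, and suppose the imbalance DTMC $\{z_\eta(k):k\in\mathbb{Z}_+\}$ is positive recurrent for every $\eta\ge\max\{\eta_0,\eta_p\}$;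 let $\bar z_\eta$ denote its steady-state random variable. Let $\sigma^\star=\sigma^c(\mu^\star)+\sigma^s(\mu^\star)$. Then, as $\eta\uparrow\infty$: (1) if $\Phi^\star\setminus\{0\}\neq\emptyset$ and $d=0$, then $\bar z_\eta/\tau_\eta\overset{D}{\to}\operatorname{Uniform}(\Phi^\star)$; (2) if $\Phi^\star\setminus\{0\}\neq\emptyset$ and $d\neq0$, then $\bar z_\eta/\tau_\eta\overset{D}{\to}\operatorname{TrunExp}\left(\frac{2d}{\sigma^\star},\Phi^\star\right)$; (3) if $\Phi^\star=\{0\}$, then $\bar z_\eta/\tau_\eta\overset{D}{\to}0$, i.e. $\lim_{\eta\uparrow\infty}P\left(|\bar z_\eta|/\tau_\eta\ge\tilde\epsilon\right)=0$ for all $\tilde\epsilon>0$.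
   Context: Notation: $\mathbb{Z}_+$ is the set of non-negative integers; $[x]^+=\max\{x,0\}$, $[x]^-=\max\{-x,0\}$; $\operatorname{clip}(x,x_{\max},x_{\min})=\max\{\min\{x,x_{\max}\},x_{\min}\}$; $\overset{D}{\to}$ is convergence in distribution. Model (matching queue). Fix constants $\lambda_{\max}\ge\lambda_{\min}\ge0$, $\mu_{\max}\ge\mu_{\min}\ge0$, $\sigma_{\max}>0$, $M>0$ and $\mu^\star$ with $\lambda_{\min}<\mu^\star<\lambda_{\max}$ and $\mu_{\min}<\mu^\star<\mu_{\max}$; continuous functions $\sigma^c,\sigma^s:\mathbb{R}\to[0,\sigma_{\max}]$; and Borel measurable control curves $\phi^c,\phi^s:\mathbb{R}\to\mathbb{R}$. For each $\eta>0$ let $\epsilon_\eta>0$, $\tau_\eta>0$, $\lambda^\star_\eta\in\mathbb{R}$, and for $z\in\mathbb{Z}$ put $$\lambda_\eta(z)=\operatorname{clip}\!\left(\lambda^\star_\eta+\epsilon_\eta\phi^c(z/\tau_\eta),\lambda_{\max},\lambda_{\min}\right),\quad \mu_\eta(z)=\operatorname{clip}\!\left(\mu^\star+\epsilon_\eta\phi^s(z/\tau_\eta),\mu_{\max},\mu_{\min}\right).$$ For each $\eta>0$ the random variables $a^c_\eta(z,k),a^s_\eta(z,k)$ ($z\in\mathbb{Z},k\in\mathbb{Z}_+$) are $\mathbb{Z}_+$-valued and mutually independent; for each $z$, the $a^c_\eta(z,k)$, $k\in\mathbb{Z}_+$, are identically distributed with generic copy $a^c_\eta(z)$, and similarly for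 $a^s_\eta(z)$. They satisfy $E[a^c_\eta(z)]=\lambda_\eta(z)$, $E[a^s_\eta(z)]=\mu_\eta(z)$, $\operatorname{Var}[a^c_\eta(z)]=\sigma^c(\lambda_\eta(z))$, $\operatorname{Var}[a^s_\eta(z)]=\sigma^s(\mu_\eta(z))$, $E[|a^c_\eta(z)|^3]\le M$, $E[|a^s_\eta(z)|^3]\le M$. The imbalance is the DTMC on $\mathbb{Z}$ with $z_\eta(0)=0$ and $z_\eta(k+1)=z_\eta(k)+a^c_\eta(z_\eta(k),k)-a^s_\eta(z_\eta(k),k)$. The arrival distributions are assumed such that this DTMC is irreducible on $\mathbb{Z}$ and aperiodic. When it is positive recurrent, $\bar z_\eta$ is a random variable with its unique stationary distribution. Asymptotic regime: as $\eta\uparrow\infty$, $\epsilon_\eta\to0$ and/or $\tau_\eta\to\infty$ (at least one holds). Distributions: $\operatorname{Uniform}(\Phi)$, for a Borel set $\Phi$ of finite non-zero Lebesgue measure $|\Phi|$, has density $\mathbb{1}\{x\in\Phi\}/|\Phi|$. $\operatorname{TrunExp}(\lambda,\Phi)$, for $\lambda\in\mathbb{R}$ and Borel $\Phi$ with $\int_\Phi e^{-\lambda t}dt<\infty$, has density $e^{-\lambda x}\mathbb{1}\{x\in\Phi\}/\int_\Phi e^{-\lambda t}dt$. *)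

theory Defs
  imports "HOL-Probability.Probability"
begin

definition clip :: "real \<Rightarrow> real \<Rightarrow> real \<Rightarrow> real" where
  "clip x x_max x_min = max (min x x_max) x_min"

definition controlled_rate ::
    "real \<Rightarrow> real \<Rightarrow> real \<Rightarrow> (real \<Rightarrow> real) \<Rightarrow> real \<Rightarrow> real \<Rightarrow> int \<Rightarrow> real" where
  "controlled_rate r \<epsilon> \<tau> \<phi> r_max r_min z = clip (r + \<epsilon> * \<phi> (of_int z / \<tau>)) r_max r_min"


section \<open>Markov chains\<close>

text \<open>
  A time-homogeneous chain is given as a family \<open>X\<close> of processes on one probability space \<open>N\<close>:
  \<open>X x k\<close> is the state at time \<open>k\<close> of the chain started in \<open>x\<close>, so that
  \<open>\<P>(w in N. X x k w = y)\<close> is the \<open>k\<close>-step transition probability from \<open>x\<close> to \<open>y\<close>.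
\<close>

definition chain_irreducible :: "'w measure \<Rightarrow> ('s \<Rightarrow> nat \<Rightarrow> 'w \<Rightarrow> 's) \<Rightarrow> bool" where
  "chain_irreducible N X \<longleftrightarrow> (\<forall>x y. \<exists>k. \<P>(w in N. X x k w = y) > 0)"

definition chain_aperiodic :: "'w measure \<Rightarrow> ('s \<Rightarrow> nat \<Rightarrow> 'w \<Rightarrow> 's) \<Rightarrow> bool" where
  "chain_aperiodic N X \<longleftrightarrow> (\<forall>x. Gcd {k. k > 0 \<and> \<P>(w in N. X x k w = x) > 0} = 1)"

text \<open>The infimum is \<open>\<infinity>\<close> on the event that the chain never returns.\<close>

definition return_time :: "('s \<Rightarrow> nat \<Rightarrow> 'w \<Rightarrow> 's) \<Rightarrow> 's \<Rightarrow> 'w \<Rightarrow> ennreal" where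
  "return_time X x w = (INF k\<in>{k. k > 0 \<and> X x k w = x}. of_nat k)"

definition chain_positive_recurrent :: "'w measure \<Rightarrow> ('s \<Rightarrow> nat \<Rightarrow> 'w \<Rightarrow> 's) \<Rightarrow> bool" where
  "chain_positive_recurrent N X \<longleftrightarrow> (\<forall>x. (\<integral>\<^sup>+ w. return_time X x w \<partial>N) < \<infinity>)"

text \<open>The balance equations for a law \<open>D\<close> on a (countable) discrete state space.\<close>

definition stationary_distribution ::
    "'w measure \<Rightarrow> ('s \<Rightarrow> nat \<Rightarrow> 'w \<Rightarrow> 's) \<Rightarrow> 's measure \<Rightarrow> bool" where
  "stationary_distribution N X D \<longleftrightarrow> prob_space D \<and> sets D = UNIV \<and>
     (\<forall>y. ((\<lambda>x. measure D {x} * \<P>(w in N. X x 1 w = y)) has_sum measure D {y}) UNIV)"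


section \<open>The matching queue\<close>

text \<open>
  The imbalance recursion from an arbitrary initial state \<open>x\<close>; the imbalance process of the
  queue is the case \<open>x = 0\<close>.
\<close>

primrec imbalance ::
    "(int \<Rightarrow> nat \<Rightarrow> 'w \<Rightarrow> nat) \<Rightarrow> (int \<Rightarrow> nat \<Rightarrow> 'w \<Rightarrow> nat) \<Rightarrow> int \<Rightarrow> nat \<Rightarrow> 'w \<Rightarrow> int" where
  "imbalance ac as x 0 w = x"
| "imbalance ac as x (Suc k) w =
     imbalance ac as x k w
       + int (ac (imbalance ac as x k w) k w) - int (as (imbalance ac as x k w) k w)"

text \<open>
  The queue for one value of the scaling parameter, with mean arrivals \<open>lam z\<close>, \<open>mu z\<close> in state \<open>z\<close>.
  The index-\<open>0\<close> variables \<open>ac z 0\<close>, \<open>as z 0\<close> serve as the generic copies. Integrability of the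
  third powers is explicit because a Bochner integral that does not exist is \<open>0\<close>.
\<close>

locale matching_queue = prob_space N
  for N :: "'w measure" +
  fixes ac as :: "int \<Rightarrow> nat \<Rightarrow> 'w \<Rightarrow> nat"
    and lam mu :: "int \<Rightarrow> real"
    and \<sigma>c \<sigma>s :: "real \<Rightarrow> real"
    and M :: real
  assumes independent:
      "indep_vars (\<lambda>_. count_space UNIV) (case_sum (\<lambda>(z, k). ac z k) (\<lambda>(z, k). as z k)) UNIV"
    and identical_c: "distr N (count_space UNIV) (ac z k) = distr N (count_space UNIV) (ac z 0)"
    and identical_s: "distr N (count_space UNIV) (as z k) = distr N (count_space UNIV) (as z 0)"
    and mean_c: "expectation (\<lambda>w. real (ac z 0 w)) = lam z"
    and mean_s: "expectation (\<lambda>w. real (as z 0 w)) = mu z"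
    and variance_c: "variance (\<lambda>w. real (ac z 0 w)) = \<sigma>c (lam z)"
    and variance_s: "variance (\<lambda>w. real (as z 0 w)) = \<sigma>s (mu z)"
    and integrable_c: "integrable N (\<lambda>w. \<bar>real (ac z 0 w)\<bar> ^ 3)"
    and integrable_s: "integrable N (\<lambda>w. \<bar>real (as z 0 w)\<bar> ^ 3)"
    and third_moment_c: "expectation (\<lambda>w. \<bar>real (ac z 0 w)\<bar> ^ 3) \<le> M"
    and third_moment_s: "expectation (\<lambda>w. \<bar>real (as z 0 w)\<bar> ^ 3) \<le> M"
    and irreducible: "chain_irreducible N (imbalance ac as)"
    and aperiodic: "chain_aperiodic N (imbalance ac as)"


section \<open>Limit laws\<close>

text \<open>
  As \<^const>\<open>weak_conv_m\<close>, but along an arbitrary filter instead of a sequence, for the laws of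
  random variables \<open>Y i\<close> on probability spaces \<open>Q i\<close>.
\<close>

definition converges_in_distribution ::
    "('i \<Rightarrow> 'b measure) \<Rightarrow> ('i \<Rightarrow> 'b \<Rightarrow> real) \<Rightarrow> real measure \<Rightarrow> 'i filter \<Rightarrow> bool" where
  "converges_in_distribution Q Y D F \<longleftrightarrow> real_distribution D \<and>
     (\<forall>x. isCont (cdf D) x \<longrightarrow> ((\<lambda>i. cdf (distr (Q i) borel (Y i)) x) \<longlongrightarrow> cdf D x) F)"

definition trunc_exp :: "real \<Rightarrow> real set \<Rightarrow> real measure" where
  "trunc_exp l A = density lborel
     (\<lambda>x. ennreal (exp (- l * x)) * indicator A x / (\<integral>\<^sup>+t\<in>A. ennreal (exp (- l * t)) \<partial>lborel))"

end

theory Submission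
  imports Defs
begin

text \<open>
  Seen on the scale \<open>\<tau>\<close> in space and \<open>\<tau>\<^sup>2\<close> in time, the imbalance is close to a diffusion. On \<open>\<Phi>_star\<close>,
  an interval with end points \<open>a \<le> 0 \<le> b\<close>, both control curves vanish, and the walk has scaled drift
  \<open>- d\<close> and variance close to \<open>\<sigma>_star\<close>. Outside \<open>\<Phi>_star\<close> the controls push it back with a scaled force of order
  \<open>\<epsilon> * \<tau>\<close>, or of order \<open>\<tau>\<close> if the rates are clipped; either force diverges. In the limit the
  diffusion is therefore reflected at \<open>a\<close> and \<open>b\<close>, and its stationary density on \<open>[a, b]\<close> is proportional to
  \<open>exp (- 2 * d * x / \<sigma>_star)\<close>.

  The proof does not pass through the process limit. The stationary law integrates the generator of
  every bounded test function to \<open>0\<close> (\<open>expectation_generator_bounded\<close>), and a Taylor expansion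
  identifies the scaled generator with drift times slope plus half the variance times curvature
  (\<open>generator_taylor3\<close>). Three families of test functions then determine the limit.

  \<^item> A parabola shows that the regions where the restoring force diverges carry no mass in the limit
    (\<open>mass_outside\<close>). If \<open>a = b\<close>, this is already the claim. Parabolas are unbounded and the
    stationary law is not known to have moments, so \<open>foster_lyapunov\<close> works with truncations.

  \<^item> A parabola with a rounded kink at \<open>y\<close> shows that the mass within distance \<open>e\<close> of \<open>y\<close> is of
    order \<open>e\<close>, also if \<open>y\<close> is an end point (\<open>mass_near_point\<close>). This excludes that mass
    accumulates at the boundary, where no lower bound on the restoring force is available.

  \<^item> The solution of the Stein equation for the half-line up to \<open>x0\<close> has a slope that vanishes
    outside \<open>[a, b]\<close>, so the unknown force there drops out, and the stationary identity becomes
    convergence of the distribution function at \<open>x0\<close> (\<open>stein_estimate\<close>). Its curvature jumps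
    at \<open>a\<close>, \<open>x0\<close> and \<open>b\<close>; the second family bounds the cost.

  The uniform case is \<open>d = 0\<close>.
\<close>

section \<open>Stationary walks on the integers\<close>

text \<open>
  On a countable type every discrete probability measure is a \<^typ>\<open>'a pmf\<close>; this turns the
  balance equations into an identity between monadic expressions.
\<close>
lemma measure_pmf_Abs_pmf:
  fixes D :: "'a::countable measure"
  assumes "prob_space D" "sets D = UNIV"
  shows "measure_pmf (Abs_pmf D) = D"
proof -
  interpret prob_space D by fact
  have "AE x in D. measure D {x} \<noteq> 0"
    using AE_support_countable[OF assms(2)] by auto
  with assms show ?thesis
    by (intro Abs_pmf_inverse) auto
qed

text \<open>
  Jumps are integers, so one third-moment bound also controls the first and second moments; the
  case \<open>j = 0\<close> has to be separated because powers are monotone in the exponent only above \<open>1\<close>.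
\<close>
lemma integer_power_le_cube:
  fixes j :: int
  shows "\<bar>real_of_int j\<bar> \<le> \<bar>real_of_int j\<bar> ^ 3" "(real_of_int j)\<^sup>2 \<le> \<bar>real_of_int j\<bar> ^ 3"
proof -
  have "\<bar>real_of_int j\<bar> = 0 \<or> \<bar>real_of_int j\<bar> \<ge> 1"
    by (cases "j = 0") auto
  then have "\<bar>real_of_int j\<bar> ^ 1 \<le> \<bar>real_of_int j\<bar> ^ 3 \<and> \<bar>real_of_int j\<bar> ^ 2 \<le> \<bar>real_of_int j\<bar> ^ 3"
    by (metis one_le_numeral order_refl power_increasing power_zero_numeral power_one_right
        semiring_norm(68) zero_power2 numeral_le_iff semiring_norm(69) semiring_norm(72) power2_abs)
  then show "\<bar>real_of_int j\<bar> \<le> \<bar>real_of_int j\<bar> ^ 3" "(real_of_int j)\<^sup>2 \<le> \<bar>real_of_int j\<bar> ^ 3"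
    by auto
qed

lemma bounded_integrable:
  fixes h :: "'a \<Rightarrow> real" and q :: "'a pmf"
  shows "(\<And>z. \<bar>h z\<bar> \<le> R) \<Longrightarrow> integrable q h"
  by (rule measure_pmf.integrable_const_bound[where B = R]) auto

text \<open>
  A Markov chain on the integers, described by the law \<open>J z\<close> of the jump out of each state \<open>z\<close>,
  together with a stationary law \<open>p\<close>. Only the jumps are assumed to have moments: \<open>p\<close> may
  have none, and the estimates below must not use any.
\<close>
locale stationary_walk =
  fixes p :: "int pmf" and J :: "int \<Rightarrow> int pmf" and C :: real
  assumes stationary: "bind_pmf p (\<lambda>z. map_pmf (\<lambda>j. z + j) (J z)) = p"
    and cube_integrable: "integrable (J z) (\<lambda>j. \<bar>real_of_int j\<bar> ^ 3)"
    and cube_bound: "measure_pmf.expectation (J z) (\<lambda>j. \<bar>real_of_int j\<bar> ^ 3) \<le> C"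
begin

definition drift :: "int \<Rightarrow> real" where
  "drift z = measure_pmf.expectation (J z) real_of_int"

definition second_moment :: "int \<Rightarrow> real" where
  "second_moment z = measure_pmf.expectation (J z) (\<lambda>j. (real_of_int j)\<^sup>2)"

definition generator :: "(int \<Rightarrow> real) \<Rightarrow> int \<Rightarrow> real" where
  "generator h z = measure_pmf.expectation (J z) (\<lambda>j. h (z + j) - h z)"

lemma jump_integrable [simp]: "integrable (J z) real_of_int"
  by (rule Bochner_Integration.integrable_bound[OF cube_integrable[of z]])
     (use integer_power_le_cube(1) in auto)

lemma jump_square_integrable [simp]: "integrable (J z) (\<lambda>j. (real_of_int j)\<^sup>2)"
  by (rule Bochner_Integration.integrable_bound[OF cube_integrable[of z]])
     (use integer_power_le_cube(2) in auto)

lemma second_moment_nonneg: "0 \<le> second_moment z"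
  unfolding second_moment_def by simp

lemma second_moment_le: "second_moment z \<le> C"
proof -
  have "second_moment z \<le> measure_pmf.expectation (J z) (\<lambda>j. \<bar>real_of_int j\<bar> ^ 3)"
    unfolding second_moment_def
    by (rule integral_mono) (auto simp: cube_integrable integer_power_le_cube)
  then show ?thesis using cube_bound[of z] by simp
qed

lemma bound_nonneg: "0 \<le> C"
  using second_moment_le[of 0] second_moment_nonneg[of 0] by simp

lemma expectation_stationary:
  fixes h :: "int \<Rightarrow> real"
  assumes "\<And>z. \<bar>h z\<bar> \<le> R"
  shows "measure_pmf.expectation p (\<lambda>z. measure_pmf.expectation (J z) (\<lambda>j. h (z + j)))
       = measure_pmf.expectation p h"
proof -
  have "measure_pmf.expectation p h
      = measure_pmf.expectation (bind_pmf p (\<lambda>z. map_pmf (\<lambda>j. z + j) (J z))) h"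
    by (simp add: stationary)
  also have "\<dots> = measure_pmf.expectation p
      (\<lambda>z. measure_pmf.expectation (map_pmf (\<lambda>j. z + j) (J z)) h)"
    unfolding measure_pmf_bind
    by (subst integral_bind[where K = "count_space UNIV" and B = R and B' = 1])
       (auto simp: measure_pmf_in_subprob_algebra assms)
  finally show ?thesis by simp
qed

lemma generator_bounded:
  assumes "\<And>z. \<bar>h z\<bar> \<le> R"
  shows "generator h z = measure_pmf.expectation (J z) (\<lambda>j. h (z + j)) - h z"
proof -
  have "integrable (J z) (\<lambda>j. h (z + j))"
    using assms by (rule bounded_integrable)
  then show ?thesis
    unfolding generator_def by simp
qed

lemma abs_generator_bounded:
  assumes "\<And>z. \<bar>h z\<bar> \<le> R"
  shows "\<bar>generator h z\<bar> \<le> 2 * R"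
proof -
  have "\<bar>generator h z\<bar> \<le> measure_pmf.expectation (J z) (\<lambda>j. \<bar>h (z + j) - h z\<bar>)"
    unfolding generator_def by (rule integral_abs_bound)
  also have "\<dots> \<le> measure_pmf.expectation (J z) (\<lambda>j. 2 * R)"
  proof (rule integral_mono)
    have b: "\<bar>h (z + j) - h z\<bar> \<le> 2 * R" for j
      using assms[of "z + j"] assms[of z] by linarith
    then show "\<And>j. \<bar>h (z + j) - h z\<bar> \<le> 2 * R" .
    show "integrable (J z) (\<lambda>j. \<bar>h (z + j) - h z\<bar>)"
      by (rule bounded_integrable[where R = "2 * R"]) (use b in auto)
  qed auto
  finally show ?thesis by simp
qed

text \<open>
  The identity that characterises the stationary law. It needs \<open>h\<close> bounded, since \<open>h\<close> need not be
  integrable under \<open>p\<close> otherwise.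
\<close>
lemma expectation_generator_bounded:
  assumes "\<And>z. \<bar>h z\<bar> \<le> R"
  shows "measure_pmf.expectation p (generator h) = 0"
proof -
  have "\<bar>measure_pmf.expectation (J z) (\<lambda>j. h (z + j))\<bar> \<le> 3 * R" for z
    using abs_generator_bounded[where h = h and R = R and z = z, OF assms]
      generator_bounded[where h = h and R = R and z = z, OF assms]
      assms[of z] by linarith
  then have "integrable p (\<lambda>z. measure_pmf.expectation (J z) (\<lambda>j. h (z + j)))" "integrable p h"
    using assms by (auto intro: bounded_integrable)
  moreover have "generator h = (\<lambda>z. measure_pmf.expectation (J z) (\<lambda>j. h (z + j)) - h z)"
    by (rule ext) (rule generator_bounded[OF assms])
  ultimately show ?thesis
    using expectation_stationary[where h = h and R = R, OF assms] by simp
qed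

lemma integrable_generator_on_sublevel:
  assumes "finite {z. h z \<le> R}"
  shows "integrable p (\<lambda>z. generator h z * indicator {z. h z \<le> R} z)"
proof (rule bounded_integrable)
  fix z
  show "\<bar>generator h z * indicator {z. h z \<le> R} z\<bar> \<le> (\<Sum>z | h z \<le> R. \<bar>generator h z\<bar>)"
    using member_le_sum[OF _ _ assms, of z "\<lambda>z. \<bar>generator h z\<bar>"]
    by (auto simp: indicator_def intro: sum_nonneg)
qed

text \<open>
  What survives of the preceding identity for unbounded \<open>h\<close>. Replace \<open>h\<close> by the bounded function
  \<open>min h R\<close>: truncating from above can only decrease the generator where \<open>h \<le> R\<close>, and makes it
  nonpositive where \<open>h > R\<close>, so the generator of \<open>h\<close> restricted to \<open>h \<le> R\<close> has nonnegative mean.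
\<close>
lemma truncated_generator_nonneg:
  assumes lower: "\<And>z. L \<le> h z" and sublevel: "finite {z. h z \<le> R}"
    and int: "\<And>z. integrable (J z) (\<lambda>j. h (z + j))"
  shows "0 \<le> measure_pmf.expectation p (\<lambda>z. generator h z * indicator {z. h z \<le> R} z)"
proof -
  define k where "k z = min (h z) R" for z
  have k: "\<bar>k z\<bar> \<le> \<bar>L\<bar> + \<bar>R\<bar>" for z
    using lower[of z] unfolding k_def by linarith
  have fin: "integrable p (\<lambda>z. generator h z * indicator {z. h z \<le> R} z)"
    by (rule integrable_generator_on_sublevel[OF sublevel])
  have le: "generator k z \<le> generator h z * indicator {z. h z \<le> R} z" for z
  proof -
    have ik: "integrable (J z) (\<lambda>j. k (z + j))"
      using k by (rule bounded_integrable)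
    show ?thesis
    proof (cases "h z \<le> R")
      case True
      have "generator k z \<le> generator h z"
        unfolding generator_def
        by (rule integral_mono) (use True ik int in \<open>auto simp: k_def\<close>)
      with True show ?thesis by simp
    next
      case False
      have "generator k z \<le> measure_pmf.expectation (J z) (\<lambda>j. 0)"
        unfolding generator_def
        by (rule integral_mono) (use False ik in \<open>auto simp: k_def\<close>)
      with False show ?thesis by simp
    qed
  qed
  have "0 = measure_pmf.expectation p (generator k)"
    using expectation_generator_bounded[OF k] by simp
  also have "\<dots> \<le> measure_pmf.expectation p (\<lambda>z. generator h z * indicator {z. h z \<le> R} z)"
    using abs_generator_bounded[OF k] by (intro integral_mono fin le bounded_integrable)
  finally show ?thesis .
qed

text \<open>
  A Foster--Lyapunov bound on a stationary probability: a test function whose generator is at most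
  \<open>a\<close> everywhere and at most \<open>a - r\<close> on \<open>S\<close> cannot have stationary drift zero unless \<open>S\<close> has mass at
  most \<open>a / r\<close>. Since \<open>h\<close> may have infinite mean under \<open>p\<close>, the bound is obtained on sublevel sets,
  which then exhaust the state space.
\<close>
lemma foster_lyapunov:
  assumes lower: "\<And>z. L \<le> h z" and sublevel: "\<And>R. finite {z. h z \<le> R}"
    and int: "\<And>z. integrable (J z) (\<lambda>j. h (z + j))"
    and gen: "\<And>z. generator h z \<le> a - r * indicator S z"
    and "0 \<le> a" "0 \<le> r"
  shows "r * measure p S \<le> a"
proof -
  have fin: "r * measure p (S \<inter> {z. h z \<le> R}) \<le> a" for R
  proof -
    have "0 \<le> measure_pmf.expectation p (\<lambda>z. generator h z * indicator {z. h z \<le> R} z)"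
      by (rule truncated_generator_nonneg[OF lower sublevel int])
    also have "\<dots> \<le> measure_pmf.expectation p (\<lambda>z. a - r * indicator (S \<inter> {z. h z \<le> R}) z)"
    proof (rule integral_mono)
      show "integrable p (\<lambda>z. generator h z * indicator {z. h z \<le> R} z)"
        by (rule integrable_generator_on_sublevel[OF sublevel])
      show "generator h z * indicator {z. h z \<le> R} z \<le> a - r * indicator (S \<inter> {z. h z \<le> R}) z" for z
        using gen[of z] \<open>0 \<le> a\<close> by (auto simp: indicator_def)
      show "integrable p (\<lambda>z. a - r * indicator (S \<inter> {z. h z \<le> R}) z)"
        by (rule bounded_integrable[where R = "\<bar>a\<bar> + \<bar>r\<bar>"]) (auto simp: indicator_def)
    qed
    also have "\<dots> = a - r * measure p (S \<inter> {z. h z \<le> R})"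
      by (subst Bochner_Integration.integral_diff)
        (auto intro!: integrable_mult_right bounded_integrable[where R = 1] split: split_indicator)
    finally show ?thesis by simp
  qed
  have "(\<lambda>n. measure p (S \<inter> {z. h z \<le> real n})) \<longlonglongrightarrow> measure p (\<Union>n. S \<inter> {z. h z \<le> real n})"
    by (intro measure_pmf.finite_Lim_measure_incseq) (auto simp: incseq_def intro: order_trans)
  moreover have "(\<Union>n. S \<inter> {z. h z \<le> real n}) = S"
    using real_arch_simple by auto
  ultimately have "(\<lambda>n. r * measure p (S \<inter> {z. h z \<le> real n})) \<longlonglongrightarrow> r * measure p S"
    by (auto intro: tendsto_mult_left)
  then show ?thesis
    by (rule LIMSEQ_le_const2) (use fin in auto)
qed

text \<open>
  On the scale \<open>t\<close> in space and \<open>t\<^sup>2\<close> in time the generator is close to \<open>g * (t * drift)\<close>, where \<open>g\<close> is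
  the slope of \<open>f\<close>. The error is only bounded, not small: it is the diffusive term itself, and this
  form serves where the second derivative of \<open>f\<close> jumps.
\<close>
lemma generator_taylor2:
  assumes f: "\<And>x u. \<bar>f (x + u) - f x - g x * u\<bar> \<le> Q * u\<^sup>2" and "t > 0"
  shows "integrable (J z) (\<lambda>j. f (real_of_int (z + j) / t))"
    and "\<bar>t\<^sup>2 * generator (\<lambda>z. f (real_of_int z / t)) z - g (real_of_int z / t) * (t * drift z)\<bar> \<le> Q * C"
proof -
  let ?x = "real_of_int z / t"
  have u: "real_of_int (z + j) / t = ?x + real_of_int j / t" for j
    by (simp add: add_divide_distrib)
  let ?e = "\<lambda>j. f (?x + real_of_int j / t) - f ?x - g ?x * (real_of_int j / t)"
  define I where "I = measure_pmf.expectation (J z) ?e"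
  have e: "\<bar>?e j\<bar> \<le> Q / t\<^sup>2 * (real_of_int j)\<^sup>2" for j
    using f[of ?x "real_of_int j / t"] by (simp add: power_divide)
  have ie: "integrable (J z) ?e"
    by (rule Bochner_Integration.integrable_bound[where f = "\<lambda>j. Q / t\<^sup>2 * (real_of_int j)\<^sup>2"])
       (simp, simp, intro AE_I2, simp only: real_norm_def, rule order_trans[OF e abs_ge_self])
  have "integrable (J z) (\<lambda>j. ?e j + f ?x + g ?x * (real_of_int j / t))"
    by (intro Bochner_Integration.integrable_add ie) auto
  then show *: "integrable (J z) (\<lambda>j. f (real_of_int (z + j) / t))"
    unfolding u by simp
  have "generator (\<lambda>z. f (real_of_int z / t)) z
      = measure_pmf.expectation (J z) (\<lambda>j. ?e j + g ?x * (real_of_int j / t))"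
    unfolding generator_def u by simp
  also have "\<dots> = measure_pmf.expectation (J z) ?e + g ?x * (drift z / t)"
    by (subst Bochner_Integration.integral_add[OF ie]) (auto simp: drift_def)
  finally have "generator (\<lambda>z. f (real_of_int z / t)) z = I + g ?x * (drift z / t)"
    unfolding I_def .
  then have "t\<^sup>2 * generator (\<lambda>z. f (real_of_int z / t)) z - g ?x * (t * drift z)
      = t\<^sup>2 * I"
    using \<open>t > 0\<close> by (simp add: field_simps power2_eq_square)
  moreover have "\<bar>I\<bar> \<le> Q / t\<^sup>2 * second_moment z"
  proof -
    have "\<bar>I\<bar> \<le> measure_pmf.expectation (J z) (\<lambda>j. \<bar>?e j\<bar>)"
      unfolding I_def by (rule integral_abs_bound)
    also have "\<dots> \<le> measure_pmf.expectation (J z) (\<lambda>j. Q / t\<^sup>2 * (real_of_int j)\<^sup>2)"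
      by (rule integral_mono) (use ie e in auto)
    finally show ?thesis by (simp add: second_moment_def)
  qed
  ultimately have "\<bar>t\<^sup>2 * generator (\<lambda>z. f (real_of_int z / t)) z - g ?x * (t * drift z)\<bar>
      \<le> t\<^sup>2 * (Q / t\<^sup>2 * second_moment z)"
    by (simp only: abs_mult) (intro mult_mono, auto)
  also have "\<dots> = Q * second_moment z"
    using \<open>t > 0\<close> by simp
  also have "\<dots> \<le> Q * C"
    using f[of 0 1] second_moment_le[of z] by (intro mult_left_mono) auto
  finally show "\<bar>t\<^sup>2 * generator (\<lambda>z. f (real_of_int z / t)) z - g ?x * (t * drift z)\<bar> \<le> Q * C" .
qed

text \<open>
  The diffusion approximation: where \<open>f\<close> has a genuine second-order expansion with curvature \<open>q\<close>, the
  error is of order \<open>1 / t\<close>. The third-moment bound on the jumps enters here.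
\<close>
lemma generator_taylor3:
  assumes f2: "\<And>x u. \<bar>f (x + u) - f x - g x * u\<bar> \<le> Q * u\<^sup>2" and "t > 0"
    and f3: "\<And>u. \<bar>f (real_of_int z / t + u) - f (real_of_int z / t) - g (real_of_int z / t) * u - q * u\<^sup>2 / 2\<bar>
               \<le> Q' * \<bar>u\<bar> ^ 3"
  shows "\<bar>t\<^sup>2 * generator (\<lambda>z. f (real_of_int z / t)) z
           - (g (real_of_int z / t) * (t * drift z) + q * second_moment z / 2)\<bar> \<le> Q' * C / t"
proof -
  let ?x = "real_of_int z / t"
  have u: "real_of_int (z + j) / t = ?x + real_of_int j / t" for j
    by (simp add: add_divide_distrib)
  let ?e = "\<lambda>j. f (?x + real_of_int j / t) - f ?x - g ?x * (real_of_int j / t) - q * (real_of_int j / t)\<^sup>2 / 2"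
  define I where "I = measure_pmf.expectation (J z) ?e"
  have "Q' \<ge> 0"
    using f3[of 1] by simp
  have e: "\<bar>?e j\<bar> \<le> Q' / t ^ 3 * \<bar>real_of_int j\<bar> ^ 3" for j
    using f3[of "real_of_int j / t"] \<open>t > 0\<close> by (simp add: power_divide)
  have ie: "integrable (J z) ?e"
    by (rule Bochner_Integration.integrable_bound[where f = "\<lambda>j. Q' / t ^ 3 * \<bar>real_of_int j\<bar> ^ 3"])
       (simp add: cube_integrable, simp, intro AE_I2, simp only: real_norm_def, rule order_trans[OF e abs_ge_self])
  have "generator (\<lambda>z. f (real_of_int z / t)) z
      = measure_pmf.expectation (J z)
          (\<lambda>j. ?e j + (g ?x * (real_of_int j / t) + q / (2 * t\<^sup>2) * (real_of_int j)\<^sup>2))"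
    unfolding generator_def u by (rule Bochner_Integration.integral_cong) (auto simp: power_divide)
  also have "\<dots> = measure_pmf.expectation (J z) ?e + (g ?x * (drift z / t) + q / (2 * t\<^sup>2) * second_moment z)"
    by (subst Bochner_Integration.integral_add[OF ie]) (auto simp: drift_def second_moment_def)
  finally have "generator (\<lambda>z. f (real_of_int z / t)) z
      = I + (g ?x * (drift z / t) + q / (2 * t\<^sup>2) * second_moment z)"
    unfolding I_def .
  then have "t\<^sup>2 * generator (\<lambda>z. f (real_of_int z / t)) z - (g ?x * (t * drift z) + q * second_moment z / 2)
      = t\<^sup>2 * I"
    using \<open>t > 0\<close> by (simp add: field_simps power2_eq_square)
  moreover have "\<bar>I\<bar>
      \<le> Q' / t ^ 3 * measure_pmf.expectation (J z) (\<lambda>j. \<bar>real_of_int j\<bar> ^ 3)"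
  proof -
    have "\<bar>I\<bar> \<le> measure_pmf.expectation (J z) (\<lambda>j. \<bar>?e j\<bar>)"
      unfolding I_def by (rule integral_abs_bound)
    also have "\<dots> \<le> measure_pmf.expectation (J z) (\<lambda>j. Q' / t ^ 3 * \<bar>real_of_int j\<bar> ^ 3)"
      by (rule integral_mono) (use ie e cube_integrable in auto)
    finally show ?thesis by simp
  qed
  moreover have "Q' / t ^ 3 * measure_pmf.expectation (J z) (\<lambda>j. \<bar>real_of_int j\<bar> ^ 3) \<le> Q' / t ^ 3 * C"
    using \<open>t > 0\<close> \<open>Q' \<ge> 0\<close> cube_bound[of z] by (intro mult_left_mono) auto
  ultimately have "\<bar>t\<^sup>2 * generator (\<lambda>z. f (real_of_int z / t)) z
      - (g ?x * (t * drift z) + q * second_moment z / 2)\<bar> \<le> t\<^sup>2 * (Q' / t ^ 3 * C)"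
    by (simp only: abs_mult) (intro mult_mono, auto)
  also have "\<dots> = Q' * C / t"
    using \<open>t > 0\<close> by (simp add: power2_eq_square power3_eq_cube)
  finally show ?thesis .
qed

end


section \<open>Taylor estimates and a test function with a rounded kink\<close>

text \<open>
  The mean value inequality for \<open>f\<close> minus a quadratic polynomial; all Taylor estimates below are
  instances. With \<open>m = 0\<close> it says that \<open>f\<close> is constant where its slope vanishes.
\<close>
lemma increment_bound_by_slope:
  fixes f g :: "real \<Rightarrow> real"
  assumes f: "\<And>s. (f has_real_derivative g s) (at s)"
    and c: "\<And>s. s \<in> closed_segment x y \<Longrightarrow> \<bar>g s - c * (s - x) - b\<bar> \<le> m"
  shows "\<bar>f y - f x - b * (y - x) - c * (y - x)\<^sup>2 / 2\<bar> \<le> m * \<bar>y - x\<bar>"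
proof -
  let ?r = "\<lambda>s. f s - b * (s - x) - c * (s - x)\<^sup>2 / 2"
  have "norm (?r y - ?r x) \<le> m * norm (y - x)"
  proof (rule field_differentiable_bound[where S = "closed_segment x y" and f' = "\<lambda>s. g s - c * (s - x) - b"])
    show "(?r has_real_derivative g z - c * (z - x) - b) (at z within closed_segment x y)" for z
      by (auto intro!: derivative_eq_intros has_field_derivative_at_within[OF f])
  qed (use c in auto)
  then show ?thesis by simp
qed

lemma abs_diff_le_on_segment:
  fixes x y s :: real
  assumes "s \<in> closed_segment x y"
  shows "\<bar>s - x\<bar> \<le> \<bar>y - x\<bar>"
  using assms by (auto simp: closed_segment_eq_real_ivl split: if_splits)

lemma taylor_remainder2:
  fixes f g :: "real \<Rightarrow> real"
  assumes f: "\<And>s. (f has_real_derivative g s) (at s)"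
    and g: "\<And>s. \<bar>g s - g x\<bar> \<le> Q * \<bar>s - x\<bar>" and "0 \<le> Q"
  shows "\<bar>f (x + u) - f x - g x * u\<bar> \<le> Q * u\<^sup>2"
proof -
  have d: "\<bar>g s - 0 * (s - x) - g x\<bar> \<le> Q * \<bar>u\<bar>" if "s \<in> closed_segment x (x + u)" for s
    using g[of s] mult_left_mono[OF abs_diff_le_on_segment[OF that] \<open>0 \<le> Q\<close>] by simp
  from increment_bound_by_slope[where f = f and g = g and y = "x + u", OF f d]
  have "\<bar>f (x + u) - f x - g x * u\<bar> \<le> Q * \<bar>u\<bar> * \<bar>u\<bar>"
    by simp
  then show ?thesis by (simp add: power2_eq_square mult.assoc)
qed

lemma taylor_remainder3:
  fixes f g :: "real \<Rightarrow> real"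
  assumes f: "\<And>s. (f has_real_derivative g s) (at s)"
    and g: "\<And>s. s \<in> closed_segment x (x + u) \<Longrightarrow> \<bar>g s - g x - q * (s - x)\<bar> \<le> Q * (s - x)\<^sup>2" and "0 \<le> Q"
  shows "\<bar>f (x + u) - f x - g x * u - q * u\<^sup>2 / 2\<bar> \<le> Q * \<bar>u\<bar> ^ 3"
proof -
  have d: "\<bar>g s - q * (s - x) - g x\<bar> \<le> Q * u\<^sup>2" if "s \<in> closed_segment x (x + u)" for s
  proof -
    have "(s - x)\<^sup>2 \<le> u\<^sup>2"
      using abs_diff_le_on_segment[OF that] by (simp add: abs_le_square_iff[symmetric])
    with g[OF that] mult_left_mono[OF this \<open>0 \<le> Q\<close>] show ?thesis
      by (simp add: algebra_simps)
  qed
  from increment_bound_by_slope[where f = f and g = g and y = "x + u", OF f d]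
  have "\<bar>f (x + u) - f x - g x * u - q * u\<^sup>2 / 2\<bar> \<le> Q * u\<^sup>2 * \<bar>u\<bar>"
    by simp
  then show ?thesis by (simp add: power2_eq_square power3_eq_cube mult.assoc)
qed

lemma abs_arctan_diff_le: "\<bar>arctan v - arctan w\<bar> \<le> \<bar>v - w\<bar>"
proof -
  have "\<bar>inverse (1 + s\<^sup>2) - 0 * (s - w) - 0\<bar> \<le> 1" for s :: real
    by (simp add: inverse_le_1_iff)
  from increment_bound_by_slope[where f = arctan and g = "\<lambda>s. inverse (1 + s\<^sup>2)" and y = v, OF DERIV_arctan this]
  show ?thesis by simp
qed

text \<open>
  The derivative \<open>1 / (1 + s\<^sup>2)\<close> of the arctangent is itself \<open>1\<close>-Lipschitz, because
  \<open>\<bar>s + w\<bar> \<le> (1 + s\<^sup>2) * (1 + w\<^sup>2)\<close>.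
\<close>
lemma abs_arctan_taylor_le:
  "\<bar>arctan v - arctan w - (v - w) / (1 + w\<^sup>2)\<bar> \<le> (v - w)\<^sup>2"
proof -
  have d: "\<bar>1 / (1 + s\<^sup>2) - 1 / (1 + w\<^sup>2)\<bar> \<le> \<bar>s - w\<bar>" for s :: real
  proof -
    have p: "1 + s\<^sup>2 > 0" "1 + w\<^sup>2 > 0"
      by (auto intro: add_pos_nonneg)
    have "\<bar>s + w\<bar> \<le> (1 + s\<^sup>2) * (1 + w\<^sup>2)"
    proof -
      have "2 * \<bar>s\<bar> \<le> 1 + s\<^sup>2" "2 * \<bar>w\<bar> \<le> 1 + w\<^sup>2"
        using sum_squares_bound[of 1 "\<bar>s\<bar>"] sum_squares_bound[of 1 "\<bar>w\<bar>"] by auto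
      moreover have "0 \<le> s\<^sup>2 * w\<^sup>2" "0 \<le> s\<^sup>2" "0 \<le> w\<^sup>2" by simp_all
      moreover have "\<bar>s + w\<bar> \<le> \<bar>s\<bar> + \<bar>w\<bar>" by simp
      moreover have "(1 + s\<^sup>2) * (1 + w\<^sup>2) = 1 + s\<^sup>2 + w\<^sup>2 + s\<^sup>2 * w\<^sup>2"
        by (simp add: algebra_simps)
      ultimately show ?thesis by linarith
    qed
    then have "\<bar>s - w\<bar> * \<bar>s + w\<bar> \<le> \<bar>s - w\<bar> * ((1 + s\<^sup>2) * (1 + w\<^sup>2))"
      by (rule mult_left_mono) auto
    moreover have "1 / (1 + s\<^sup>2) - 1 / (1 + w\<^sup>2) = - ((s - w) * (s + w)) / ((1 + s\<^sup>2) * (1 + w\<^sup>2))"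
      using p by (simp add: field_simps power2_eq_square)
    ultimately show ?thesis
      using p by (simp add: abs_mult divide_le_eq)
  qed
  have *: "\<bar>inverse (1 + s\<^sup>2) - 0 * (s - w) - 1 / (1 + w\<^sup>2)\<bar> \<le> \<bar>v - w\<bar>" if "s \<in> closed_segment w v" for s
    using d[of s] abs_diff_le_on_segment[OF that] by (simp add: inverse_eq_divide)
  from increment_bound_by_slope[where f = arctan and g = "\<lambda>s. inverse (1 + s\<^sup>2)" and y = v, OF DERIV_arctan *]
  show ?thesis
    by (simp add: power2_eq_square)
qed

text \<open>
  The primitive of the arctangent: it is smooth, grows like \<open>pi / 2 * \<bar>x\<bar>\<close>, and its second derivative
  \<open>1 / (1 + x\<^sup>2)\<close> is a bump at the origin.
\<close>
definition peak_integral :: "real \<Rightarrow> real" where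
  "peak_integral x = x * arctan x - ln (1 + x\<^sup>2) / 2"

lemma peak_integral_derivative: "(peak_integral has_real_derivative arctan x) (at x)"
proof -
  have p: "1 + x\<^sup>2 > 0"
    by (auto intro: add_pos_nonneg)
  show ?thesis
    unfolding peak_integral_def
    by (auto intro!: derivative_eq_intros p) (use p in \<open>simp add: field_simps\<close>)
qed

lemma peak_integral_le: "peak_integral x \<le> 2 * \<bar>x\<bar>"
proof -
  have "x * arctan x \<le> \<bar>x\<bar> * \<bar>arctan x\<bar>"
    by (metis abs_ge_self abs_mult)
  also have "\<dots> \<le> \<bar>x\<bar> * 2"
  proof (rule mult_left_mono)
    show "\<bar>arctan x\<bar> \<le> 2"
      using arctan_bounded[of x] pi_less_4 by auto
  qed auto
  finally have "x * arctan x \<le> 2 * \<bar>x\<bar>"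
    by simp
  moreover have "0 \<le> ln (1 + x\<^sup>2)"
    by simp
  ultimately show ?thesis
    unfolding peak_integral_def by linarith
qed

text \<open>
  A test function for the mass close to a point \<open>y\<close>: a parabola with a rounded kink of width \<open>e\<close>
  pointing upwards at \<open>y\<close>. Its curvature is of order \<open>- 1 / e\<close> within distance \<open>e\<close> of \<open>y\<close> and at most
  \<open>A\<close> everywhere, so the stationary law can put at most a mass of order \<open>e\<close> there. The
  parabola makes the function coercive; for \<open>A\<close> large it also makes the slope point outwards outside
  the interval, so that the restoring drift acts in the favourable direction.
\<close>
definition concentration_test :: "real \<Rightarrow> real \<Rightarrow> real \<Rightarrow> real \<Rightarrow> real \<Rightarrow> real" where
  "concentration_test A c e y x = A * (x - c)\<^sup>2 / 2 - e * peak_integral ((x - y) / e)"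

definition concentration_slope :: "real \<Rightarrow> real \<Rightarrow> real \<Rightarrow> real \<Rightarrow> real \<Rightarrow> real" where
  "concentration_slope A c e y x = A * (x - c) - arctan ((x - y) / e)"

definition concentration_curvature :: "real \<Rightarrow> real \<Rightarrow> real \<Rightarrow> real \<Rightarrow> real" where
  "concentration_curvature A e y x = A - 1 / (e * (1 + ((x - y) / e)\<^sup>2))"

lemma concentration_test_derivative:
  assumes "e > 0"
  shows "(concentration_test A c e y has_real_derivative concentration_slope A c e y x) (at x)"
  unfolding concentration_test_def concentration_slope_def using assms
  by (auto intro!: derivative_eq_intros DERIV_chain'[OF _ peak_integral_derivative] simp: field_simps)

lemma concentration_test_taylor2:
  assumes "e > 0" "A \<ge> 0"
  shows "\<bar>concentration_test A c e y (x + u) - concentration_test A c e y x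
           - concentration_slope A c e y x * u\<bar> \<le> (A + 1 / e) * u\<^sup>2"
proof (rule taylor_remainder2[OF concentration_test_derivative[OF \<open>e > 0\<close>]])
  fix s
  have "\<bar>arctan ((s - y) / e) - arctan ((x - y) / e)\<bar> \<le> \<bar>(s - y) / e - (x - y) / e\<bar>"
    by (rule abs_arctan_diff_le)
  also have "\<dots> = 1 / e * \<bar>s - x\<bar>"
    using assms by (simp add: diff_divide_distrib[symmetric])
  finally have "\<bar>arctan ((s - y) / e) - arctan ((x - y) / e)\<bar> \<le> 1 / e * \<bar>s - x\<bar>" .
  moreover have "concentration_slope A c e y s - concentration_slope A c e y x
     = A * (s - x) - (arctan ((s - y) / e) - arctan ((x - y) / e))"
    unfolding concentration_slope_def by (simp add: algebra_simps)
  moreover have "\<bar>A * (s - x)\<bar> = A * \<bar>s - x\<bar>"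
    using assms by (simp add: abs_mult)
  ultimately show "\<bar>concentration_slope A c e y s - concentration_slope A c e y x\<bar> \<le> (A + 1 / e) * \<bar>s - x\<bar>"
    by (simp only: distrib_right)
qed (use assms in auto)

lemma concentration_test_taylor3:
  assumes "e > 0"
  shows "\<bar>concentration_test A c e y (x + u) - concentration_test A c e y x
           - concentration_slope A c e y x * u - concentration_curvature A e y x * u\<^sup>2 / 2\<bar> \<le> 1 / e\<^sup>2 * \<bar>u\<bar> ^ 3"
proof (rule taylor_remainder3[OF concentration_test_derivative[OF \<open>e > 0\<close>]])
  fix s
  let ?v = "(s - y) / e" and ?w = "(x - y) / e"
  have vw: "?v - ?w = (s - x) / e"
    by (simp add: diff_divide_distrib[symmetric])
  have "concentration_slope A c e y s - concentration_slope A c e y x - concentration_curvature A e y x * (s - x)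
     = - (arctan ?v - arctan ?w - (?v - ?w) / (1 + ?w\<^sup>2))"
    unfolding concentration_slope_def concentration_curvature_def vw by (simp add: algebra_simps)
  then have "\<bar>concentration_slope A c e y s - concentration_slope A c e y x - concentration_curvature A e y x * (s - x)\<bar>
     \<le> (?v - ?w)\<^sup>2"
    using abs_arctan_taylor_le[of ?v ?w] by simp
  then show "\<bar>concentration_slope A c e y s - concentration_slope A c e y x - concentration_curvature A e y x * (s - x)\<bar>
     \<le> 1 / e\<^sup>2 * (s - x)\<^sup>2"
    unfolding vw by (simp add: power_divide)
qed (use assms in auto)

lemma quadratic_minus_linear_coercive:
  fixes A :: real
  assumes "A > 0"
  shows "A / 4 * (x - c)\<^sup>2 - (4 / A + 2 * \<bar>c - y\<bar>) \<le> A * (x - c)\<^sup>2 / 2 - 2 * \<bar>x - y\<bar>"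
proof -
  define v where "v = \<bar>x - c\<bar>"
  have "\<bar>x - y\<bar> \<le> v + \<bar>c - y\<bar>"
    unfolding v_def by linarith
  moreover have "2 * v \<le> A / 4 * v\<^sup>2 + 4 / A"
  proof -
    have "0 \<le> (A * v - 4)\<^sup>2 / (4 * A)"
      using assms by simp
    also have "\<dots> = A / 4 * v\<^sup>2 + 4 / A - 2 * v"
      using assms by (simp add: power2_eq_square field_simps)
    finally show ?thesis by simp
  qed
  moreover have "v\<^sup>2 = (x - c)\<^sup>2"
    unfolding v_def by simp
  ultimately show ?thesis by (simp add: field_simps)
qed

text \<open>
  The linear growth of the kink is absorbed by half of the parabola, uniformly in \<open>e\<close>.
\<close>
lemma concentration_test_coercive:
  assumes "e > 0" "A > 0"
  shows "A / 4 * (x - c)\<^sup>2 - (4 / A + 2 * \<bar>c - y\<bar>) \<le> concentration_test A c e y x"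
proof -
  have "e * peak_integral ((x - y) / e) \<le> e * (2 * \<bar>(x - y) / e\<bar>)"
    using assms by (intro mult_left_mono peak_integral_le) auto
  also have "\<dots> = 2 * \<bar>x - y\<bar>"
    using assms by simp
  finally show ?thesis
    using quadratic_minus_linear_coercive[OF \<open>A > 0\<close>, of x c y]
    unfolding concentration_test_def by linarith
qed

lemma finite_sublevel_coercive:
  fixes f :: "real \<Rightarrow> real"
  assumes f: "\<And>x. A * (x - c)\<^sup>2 - D \<le> f x" and "A > 0" "t > 0"
  shows "finite {z :: int. f (real_of_int z / t) \<le> R}"
proof (rule finite_subset)
  define v where "v = \<bar>c\<bar> + sqrt (\<bar>R + D\<bar> / A)"
  show "finite {\<lceil>- (t * v)\<rceil>..\<lfloor>t * v\<rfloor>}" by simp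
  show "{z. f (real_of_int z / t) \<le> R} \<subseteq> {\<lceil>- (t * v)\<rceil>..\<lfloor>t * v\<rfloor>}"
  proof
    fix z :: int
    assume "z \<in> {z. f (real_of_int z / t) \<le> R}"
    then have "A * (real_of_int z / t - c)\<^sup>2 \<le> \<bar>R + D\<bar>"
      using f[of "real_of_int z / t"] by simp
    then have "(real_of_int z / t - c)\<^sup>2 \<le> \<bar>R + D\<bar> / A"
      using \<open>A > 0\<close> by (simp add: field_simps)
    then have "\<bar>real_of_int z / t - c\<bar> \<le> sqrt (\<bar>R + D\<bar> / A)"
      using real_le_rsqrt[of "\<bar>real_of_int z / t - c\<bar>"] by simp
    then have "\<bar>real_of_int z / t\<bar> \<le> v"
      unfolding v_def by linarith
    then have "\<bar>real_of_int z\<bar> \<le> t * v"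
      using \<open>t > 0\<close> by (simp add: field_simps)
    then show "z \<in> {\<lceil>- (t * v)\<rceil>..\<lfloor>t * v\<rfloor>}"
      by (simp add: ceiling_le_iff le_floor_iff abs_le_iff)
  qed
qed


section \<open>The Stein equation on an interval\<close>

lemma clip_nonexpansive:
  fixes a b s t :: real
  assumes "a \<le> b"
  shows "\<bar>max a (min b s) - max a (min b t)\<bar> \<le> \<bar>s - t\<bar>"
  using assms by (auto simp: max_def min_def)

lemma lipschitz_on_interval:
  fixes G G' :: "real \<Rightarrow> real"
  assumes "\<And>t. (G has_real_derivative G' t) (at t)" "\<And>t. t \<in> {a..b} \<Longrightarrow> \<bar>G' t\<bar> \<le> L"
    and "s \<in> {a..b}" "t \<in> {a..b}"
  shows "\<bar>G s - G t\<bar> \<le> L * \<bar>s - t\<bar>"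
  using field_differentiable_bound[of "{a..b}" G G' L s t] assms
  by (auto intro: has_field_derivative_at_within)

text \<open>
  A solution of \<open>G' = k + l * G\<close> is Lipschitz on an interval where \<open>G'\<close> is bounded, hence so is \<open>G'\<close>
  itself; no second derivative has to be computed.
\<close>
lemma linear_ode_taylor:
  fixes G :: "real \<Rightarrow> real"
  assumes G: "\<And>t. (G has_real_derivative k + l * G t) (at t)"
    and L: "\<And>t. t \<in> {a..b} \<Longrightarrow> \<bar>k + l * G t\<bar> \<le> L"
    and "r \<in> {a..b}" "t \<in> {a..b}"
  shows "\<bar>G r - G t - (k + l * G t) * (r - t)\<bar> \<le> \<bar>l\<bar> * L * (r - t)\<^sup>2"
proof -
  have "0 \<le> L"
    using L[OF \<open>r \<in> {a..b}\<close>] by linarith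
  have d: "\<bar>(k + l * G s) - 0 * (s - t) - (k + l * G t)\<bar> \<le> \<bar>l\<bar> * L * \<bar>r - t\<bar>"
    if s: "s \<in> closed_segment t r" for s
  proof -
    have "s \<in> {a..b}"
      using s assms(3,4) by (auto simp: closed_segment_eq_real_ivl split: if_splits)
    then have "\<bar>G s - G t\<bar> \<le> L * \<bar>s - t\<bar>"
      using \<open>t \<in> {a..b}\<close> by (intro lipschitz_on_interval[where a = a and b = b, OF G L]) auto
    also have "\<dots> \<le> L * \<bar>r - t\<bar>"
      using abs_diff_le_on_segment[OF s] \<open>0 \<le> L\<close> by (rule mult_left_mono)
    finally have "\<bar>l\<bar> * \<bar>G s - G t\<bar> \<le> \<bar>l\<bar> * (L * \<bar>r - t\<bar>)"
      by (rule mult_left_mono) simp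
    moreover have "(k + l * G s) - 0 * (s - t) - (k + l * G t) = l * (G s - G t)"
      by (simp add: algebra_simps)
    ultimately show ?thesis
      by (simp add: abs_mult mult.assoc)
  qed
  from increment_bound_by_slope[where f = G and g = "\<lambda>t. k + l * G t" and x = t and y = r, OF G d]
  show ?thesis by (simp add: power2_eq_square mult.assoc)
qed

text \<open>
  For the density proportional to \<open>exp (- l * t)\<close> on \<open>(a, b)\<close>, whose distribution function is
  \<open>W / W b\<close>, the Stein equation of the half-line \<open>(-\<infinity>, x0]\<close> is
  \<open>s / 2 * (g' - l * g) = 1{t \<le> x0} - F\<close>. The solution that vanishes at \<open>a\<close> vanishes at \<open>b\<close> too,
  precisely because \<open>F\<close> is the probability of the half-line. Extended by \<open>0\<close> it is Lipschitz on
  the whole line, with kinks at \<open>a\<close>, \<open>x0\<close> and \<open>b\<close> only. The statement gives \<open>g'\<close> through its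
  first-order expansion on either side of \<open>x0\<close>.
\<close>
lemma stein_slope_exists:
  fixes W :: "real \<Rightarrow> real"
  assumes "a < x0" "x0 < b" "s > 0"
    and W: "\<And>t. (W has_real_derivative exp (- l * t)) (at t)" and "W a = 0" "W b > 0"
  defines "F \<equiv> W x0 / W b"
  obtains g L where
    "0 < L" "\<And>r t. \<bar>g r - g t\<bar> \<le> L * \<bar>r - t\<bar>" "\<And>t. t \<le> a \<or> b \<le> t \<Longrightarrow> g t = 0" "\<And>t. \<bar>g t\<bar> \<le> L"
    "\<And>t. t \<in> {a..b} \<Longrightarrow> \<bar>2 / s * ((if t \<le> x0 then 1 else 0) - F) + l * g t\<bar> \<le> L"
    "\<And>r t. r \<in> {a..x0} \<and> t \<in> {a..x0} \<or> r \<in> {x0<..b} \<and> t \<in> {x0<..b} \<Longrightarrow>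
       \<bar>g r - g t - (2 / s * ((if t \<le> x0 then 1 else 0) - F) + l * g t) * (r - t)\<bar> \<le> L * (r - t)\<^sup>2"
proof -
  \<comment> \<open>The solutions of the equation to the left and to the right of \<open>x0\<close>, with value \<open>0\<close> at \<open>a\<close> and at \<open>b\<close>; they agree at \<open>x0\<close>.\<close>
  define G1 where "G1 t = 2 / s * (1 - F) * (W t * exp (l * t))" for t
  define G2 where "G2 t = 2 / s * F * ((W b - W t) * exp (l * t))" for t
  define k1 where "k1 = 2 / s * (1 - F)"
  define k2 where "k2 = 2 / s * (- F)"
  have ee: "exp (- l * t) * exp (l * t) = 1" for t
    by (simp add: exp_add[symmetric])
  have G1: "(G1 has_real_derivative k1 + l * G1 t) (at t)" for t
    unfolding G1_def
    by (rule derivative_eq_intros W refl)+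
       (use ee[of t] \<open>s > 0\<close> in \<open>simp add: k1_def G1_def field_simps\<close>)
  have G2: "(G2 has_real_derivative k2 + l * G2 t) (at t)" for t
    unfolding G2_def
    by (rule derivative_eq_intros W refl)+
       (use ee[of t] \<open>s > 0\<close> in \<open>simp add: k2_def G2_def field_simps\<close>)
  have ends: "G1 a = 0" "G2 b = 0"
    using \<open>W a = 0\<close> by (simp_all add: G1_def G2_def)
  have glue: "G1 x0 = G2 x0"
    using \<open>W b > 0\<close> by (simp add: G1_def G2_def F_def field_simps)
  have bounded: "\<exists>C. \<forall>t\<in>{a..b}. \<bar>k + l * G t\<bar> \<le> C"
    if G: "\<And>t. (G has_real_derivative G' t) (at t)" for k and G G' :: "real \<Rightarrow> real"
  proof -
    have "isCont G t" for t
      by (rule DERIV_isCont[OF G])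
    then have "continuous_on {a..b} (\<lambda>t. k + l * G t)"
      by (intro continuous_on_add continuous_on_mult continuous_on_const)
         (simp add: continuous_at_imp_continuous_on)
    then have "bounded ((\<lambda>t. k + l * G t) ` {a..b})"
      by (intro compact_imp_bounded compact_continuous_image) auto
    then show ?thesis
      unfolding bounded_iff by simp
  qed
  obtain C1 where C1: "\<And>t. t \<in> {a..b} \<Longrightarrow> \<bar>k1 + l * G1 t\<bar> \<le> C1"
    using bounded[OF G1] by blast
  obtain C2 where C2: "\<And>t. t \<in> {a..b} \<Longrightarrow> \<bar>k2 + l * G2 t\<bar> \<le> C2"
    using bounded[OF G2] by blast
  define C where "C = \<bar>C1\<bar> + \<bar>C2\<bar> + 1"
  have C: "\<bar>k1 + l * G1 t\<bar> \<le> C" "\<bar>k2 + l * G2 t\<bar> \<le> C" if "t \<in> {a..b}" for t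
    using C1[OF that] C2[OF that] unfolding C_def by linarith+
  have "C > 0" by (simp add: C_def)
  \<comment> \<open>Clipping the arguments glues the pieces and extends them by constants without losing the Lipschitz property.\<close>
  define g where "g t = G1 (max a (min x0 t)) + (G2 (max x0 (min b t)) - G2 x0)" for t
  have g_left: "g t = G1 t" if "t \<in> {a..x0}" for t
    using that \<open>x0 < b\<close> by (cases "t = x0") (simp_all add: g_def max_def min_def)
  have g_right: "g t = G2 t" if "t \<in> {x0..b}" for t
    using that \<open>a < x0\<close> glue by (cases "t = b") (simp_all add: g_def max_def min_def)
  have g_out: "g t = 0" if "t \<le> a \<or> b \<le> t" for t
    using that ends glue assms(1,2) by (auto simp: g_def max_def min_def)
  have lip: "\<bar>g r - g t\<bar> \<le> 2 * C * \<bar>r - t\<bar>" for r t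
  proof -
    have "\<bar>G1 (max a (min x0 r)) - G1 (max a (min x0 t))\<bar> \<le> C * \<bar>max a (min x0 r) - max a (min x0 t)\<bar>"
      by (rule lipschitz_on_interval[OF G1 C(1), of a b]) (use assms(1,2) in auto)
    also have "\<dots> \<le> C * \<bar>r - t\<bar>"
      using \<open>C > 0\<close> assms(1) by (intro mult_left_mono clip_nonexpansive) auto
    finally have 1: "\<bar>G1 (max a (min x0 r)) - G1 (max a (min x0 t))\<bar> \<le> C * \<bar>r - t\<bar>" .
    have "\<bar>G2 (max x0 (min b r)) - G2 (max x0 (min b t))\<bar> \<le> C * \<bar>max x0 (min b r) - max x0 (min b t)\<bar>"
      by (rule lipschitz_on_interval[OF G2 C(2), of a b]) (use assms(1,2) in auto)
    also have "\<dots> \<le> C * \<bar>r - t\<bar>"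
      using \<open>C > 0\<close> assms(2) by (intro mult_left_mono clip_nonexpansive) auto
    finally have 2: "\<bar>G2 (max x0 (min b r)) - G2 (max x0 (min b t))\<bar> \<le> C * \<bar>r - t\<bar>" .
    have "g r - g t = (G1 (max a (min x0 r)) - G1 (max a (min x0 t)))
        + (G2 (max x0 (min b r)) - G2 (max x0 (min b t)))"
      by (simp add: g_def)
    then show ?thesis
      using order_trans[OF abs_triangle_ineq add_mono[OF 1 2]] by (simp only: mult_2 distrib_right)
  qed
  have bd: "\<bar>g t\<bar> \<le> 2 * C * (b - a)" for t
  proof (cases "t \<le> a \<or> b \<le> t")
    case True
    then show ?thesis using g_out[OF True] \<open>C > 0\<close> assms(1,2) by simp
  next
    case False
    have "\<bar>g t - g a\<bar> \<le> 2 * C * \<bar>t - a\<bar>" by (rule lip)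
    also have "\<dots> \<le> 2 * C * (b - a)"
      using False \<open>C > 0\<close> by (intro mult_left_mono) auto
    finally show ?thesis using g_out[of a] by simp
  qed
  define L where "L = 2 * C + 2 * C * (b - a) + \<bar>l\<bar> * C"
  have "0 \<le> 2 * C * (b - a)" "0 \<le> \<bar>l\<bar> * C"
    using \<open>C > 0\<close> assms(1,2) by simp_all
  then have L: "2 * C \<le> L" "2 * C * (b - a) \<le> L" "\<bar>l\<bar> * C \<le> L" "C \<le> L"
    using \<open>C > 0\<close> unfolding L_def by linarith+
  show thesis
  proof (rule that[of L g])
    show "0 < L" using L(4) \<open>C > 0\<close> by linarith
    show "\<bar>g r - g t\<bar> \<le> L * \<bar>r - t\<bar>" for r t
      using order_trans[OF lip mult_right_mono[OF L(1)]] by simp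
    show "\<bar>g t\<bar> \<le> L" for t
      using bd[of t] L(2) by linarith
    show "g t = 0" if "t \<le> a \<or> b \<le> t" for t using that by (rule g_out)
    show "\<bar>2 / s * ((if t \<le> x0 then 1 else 0) - F) + l * g t\<bar> \<le> L" if "t \<in> {a..b}" for t
    proof (cases "t \<le> x0")
      case True
      then show ?thesis
        using C(1)[OF that] L(4) g_left[of t] that by (simp add: k1_def)
    next
      case False
      then show ?thesis
        using C(2)[OF that] L(4) g_right[of t] that by (simp add: k2_def)
    qed
    show "\<bar>g r - g t - (2 / s * ((if t \<le> x0 then 1 else 0) - F) + l * g t) * (r - t)\<bar> \<le> L * (r - t)\<^sup>2"
      if rt: "r \<in> {a..x0} \<and> t \<in> {a..x0} \<or> r \<in> {x0<..b} \<and> t \<in> {x0<..b}" for r t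
      using rt
    proof
      assume *: "r \<in> {a..x0} \<and> t \<in> {a..x0}"
      then have "\<bar>G1 r - G1 t - (k1 + l * G1 t) * (r - t)\<bar> \<le> \<bar>l\<bar> * C * (r - t)\<^sup>2"
        using assms(2) by (intro linear_ode_taylor[OF G1 C(1), of a b]) auto
      also have "\<dots> \<le> L * (r - t)\<^sup>2"
        using L(3) by (rule mult_right_mono) simp
      finally show ?thesis
        using * g_left[of r] g_left[of t] by (simp add: k1_def)
    next
      assume *: "r \<in> {x0<..b} \<and> t \<in> {x0<..b}"
      then have "\<bar>G2 r - G2 t - (k2 + l * G2 t) * (r - t)\<bar> \<le> \<bar>l\<bar> * C * (r - t)\<^sup>2"
        using assms(1) by (intro linear_ode_taylor[OF G2 C(2), of a b]) auto
      also have "\<dots> \<le> L * (r - t)\<^sup>2"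
        using L(3) by (rule mult_right_mono) simp
      finally show ?thesis
        using * g_right[of r] g_right[of t] by (simp add: k2_def)
    qed
  qed
qed

text \<open>
  The primitive \<open>f\<close> of the solution \<open>g\<close> above serves as test function. It is bounded, since \<open>g\<close>
  vanishes outside \<open>[a, b]\<close>, so the stationary law may be tested against it without moments.
  The function \<open>q\<close> stands for \<open>f''\<close>, which does not exist at the three kinks: the cubic remainder is
  available at distance more than \<open>e\<close> from them, with a constant that blows up as \<open>e\<close> decreases,
  whereas the quadratic one holds everywhere.
\<close>
lemma stein_test_exists:
  fixes W :: "real \<Rightarrow> real"
  assumes ab: "a < x0" "x0 < b" and "s > 0"
    and W: "\<And>t. (W has_real_derivative exp (- l * t)) (at t)" and "W a = 0" "W b > 0"
  obtains f g q L where
    "0 < L" "\<And>t. \<bar>f t\<bar> \<le> L" "\<And>t. \<bar>g t\<bar> \<le> L" "\<And>t. \<bar>q t\<bar> \<le> L"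
    "\<And>x u. \<bar>f (x + u) - f x - g x * u\<bar> \<le> L * u\<^sup>2"
    "\<And>t. t \<notin> {a<..<b} \<Longrightarrow> g t = 0" "\<And>t. t \<notin> {a<..<b} \<Longrightarrow> q t = 0"
    "\<And>t. t \<in> {a<..<b} \<Longrightarrow> q t = 2 / s * ((if t \<le> x0 then 1 else 0) - W x0 / W b) + l * g t"
    "\<And>e x u. e > 0 \<Longrightarrow> (\<And>y. y \<in> {a, x0, b} \<Longrightarrow> e < \<bar>x - y\<bar>) \<Longrightarrow>
       \<bar>f (x + u) - f x - g x * u - q x * u\<^sup>2 / 2\<bar> \<le> (L + 2 * L / e) * \<bar>u\<bar> ^ 3"
proof -
  obtain g L where L: "0 < L"
    and lip: "\<And>r t. \<bar>g r - g t\<bar> \<le> L * \<bar>r - t\<bar>"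
    and out: "\<And>t. t \<le> a \<or> b \<le> t \<Longrightarrow> g t = 0" and bd: "\<And>t. \<bar>g t\<bar> \<le> L"
    and qb: "\<And>t. t \<in> {a..b} \<Longrightarrow> \<bar>2 / s * ((if t \<le> x0 then 1 else 0) - W x0 / W b) + l * g t\<bar> \<le> L"
    and ode: "\<And>r t. r \<in> {a..x0} \<and> t \<in> {a..x0} \<or> r \<in> {x0<..b} \<and> t \<in> {x0<..b} \<Longrightarrow>
       \<bar>g r - g t - (2 / s * ((if t \<le> x0 then 1 else 0) - W x0 / W b) + l * g t) * (r - t)\<bar> \<le> L * (r - t)\<^sup>2"
    by (rule stein_slope_exists[OF assms]) (rule that)
  define q where "q t = (if t \<in> {a<..<b} then 2 / s * ((if t \<le> x0 then 1 else 0) - W x0 / W b) + l * g t else 0)" for t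
  have qL: "\<bar>q t\<bar> \<le> L" for t
    using qb[of t] L by (auto simp: q_def)
  have cont: "isCont g t" for t
  proof -
    have "L-lipschitz_on UNIV g"
      using lip L by (auto intro!: lipschitz_onI simp: dist_real_def)
    then show ?thesis
      using lipschitz_on_continuous_on continuous_on_eq_continuous_at open_UNIV by blast
  qed
  obtain f0 where f0: "\<And>t. (f0 has_real_derivative g t) (at t)"
    using einterval_antiderivative[of "-\<infinity>" "\<infinity>" g] cont
    by (auto simp: has_real_derivative_iff_has_vector_derivative)
  define f where "f t = f0 t - f0 a" for t
  have f: "(f has_real_derivative g t) (at t)" for t
    unfolding f_def by (auto intro!: derivative_eq_intros f0)
  have fb: "\<bar>f t\<bar> \<le> L * (b - a)" for t
  proof -
    have inner: "\<bar>f t - f a\<bar> \<le> L * \<bar>t - a\<bar>" for t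
      using increment_bound_by_slope[of f g a t 0 0 L] f bd by simp
    have flat: "f t = f r" if "\<And>s. s \<in> closed_segment r t \<Longrightarrow> g s = 0" for r t
      using increment_bound_by_slope[of f g r t 0 0 0] f that by simp
    have "f a = 0" by (simp add: f_def)
    consider "t \<le> a" | "a \<le> t" "t \<le> b" | "b \<le> t" by linarith
    then show ?thesis
    proof cases
      case 1
      then have "f t = f a" by (intro flat out) (auto simp: closed_segment_eq_real_ivl split: if_splits)
      then show ?thesis using \<open>f a = 0\<close> L ab by simp
    next
      case 2
      then have "\<bar>f t\<bar> \<le> L * (t - a)"
        using inner[of t] \<open>f a = 0\<close> by simp
      also have "\<dots> \<le> L * (b - a)"
        using 2 L by (intro mult_left_mono) auto
      finally show ?thesis .
    next
      case 3
      then have "f t = f b" by (intro flat out) (auto simp: closed_segment_eq_real_ivl split: if_splits)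
      then show ?thesis using inner[of b] \<open>f a = 0\<close> ab by simp
    qed
  qed
  define L' where "L' = L + L * (b - a)"
  have "0 \<le> L * (b - a)" using L ab by simp
  then have L': "L \<le> L'" "L * (b - a) \<le> L'" "0 < L'"
    using L unfolding L'_def by linarith+
  have t2: "\<bar>f (x + u) - f x - g x * u\<bar> \<le> L * u\<^sup>2" for x u
    by (rule taylor_remainder2[OF f lip]) (use L in simp)
  show thesis
  proof (rule that[of L' f g q])
    show "\<bar>f (x + u) - f x - g x * u\<bar> \<le> L' * u\<^sup>2" for x u
      using order_trans[OF t2 mult_right_mono[OF L'(1)]] by simp
    show "\<bar>f (x + u) - f x - g x * u - q x * u\<^sup>2 / 2\<bar> \<le> (L' + 2 * L' / e) * \<bar>u\<bar> ^ 3"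
      if "e > 0" and far: "\<And>y. y \<in> {a, x0, b} \<Longrightarrow> e < \<bar>x - y\<bar>" for e x u
    \<comment> \<open>A step of length at most \<open>e\<close> crosses no kink. For a longer step \<open>u\<^sup>2 \<le> \<bar>u\<bar> ^ 3 / e\<close>, and the quadratic bounds suffice.\<close>
    proof (cases "\<bar>u\<bar> \<le> e")
      case True
      have "\<bar>f (x + u) - f x - g x * u - q x * u\<^sup>2 / 2\<bar> \<le> L * \<bar>u\<bar> ^ 3"
      proof (rule taylor_remainder3[OF f])
        fix r assume r: "r \<in> closed_segment x (x + u)"
        have re: "\<bar>r - x\<bar> \<le> e"
          using abs_diff_le_on_segment[OF r] True by simp
        have "x + e < a \<or> a + e < x" "x + e < x0 \<or> x0 + e < x" "x + e < b \<or> b + e < x"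
          using far[of a] far[of x0] far[of b] by auto
        then have "x < a \<and> r < a \<or> x > b \<and> r > b \<or> a < x \<and> x < x0 \<and> a < r \<and> r < x0
          \<or> x0 < x \<and> x < b \<and> x0 < r \<and> r < b"
          using re ab \<open>e > 0\<close> by argo
        then show "\<bar>g r - g x - q x * (r - x)\<bar> \<le> L * (r - x)\<^sup>2"
        proof (elim disjE)
          assume "a < x \<and> x < x0 \<and> a < r \<and> r < x0"
          then show ?thesis using ode[of r x] ab by (simp add: q_def)
        next
          assume "x0 < x \<and> x < b \<and> x0 < r \<and> r < b"
          then show ?thesis using ode[of r x] ab by (simp add: q_def)
        qed (use out[of r] out[of x] L ab in \<open>simp_all add: q_def\<close>)
      qed (use L in simp)
      also have "\<dots> \<le> (L' + 2 * L' / e) * \<bar>u\<bar> ^ 3"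
        using L' \<open>e > 0\<close> by (intro mult_right_mono) (auto intro: add_increasing2)
      finally show ?thesis .
    next
      case False
      have "\<bar>q x * u\<^sup>2 / 2\<bar> \<le> L * u\<^sup>2 / 2"
        using qL[of x] by (simp add: abs_mult mult_right_mono)
      then have "\<bar>f (x + u) - f x - g x * u - q x * u\<^sup>2 / 2\<bar> \<le> L * u\<^sup>2 + L * u\<^sup>2 / 2"
        using t2[of x u] by linarith
      also have "\<dots> \<le> 2 * L * u\<^sup>2"
        using L by simp
      also have "\<dots> \<le> 2 * L' * u\<^sup>2"
        using L' by (intro mult_right_mono) auto
      also have "\<dots> \<le> 2 * L' * (u\<^sup>2 * (\<bar>u\<bar> / e))"
        using False \<open>e > 0\<close> L' by (intro mult_left_mono mult_le_cancel_left1[THEN iffD2]) auto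
      also have "\<dots> = (2 * L' / e) * \<bar>u\<bar> ^ 3"
        by (simp add: power3_eq_cube power2_eq_square mult.assoc)
      also have "\<dots> \<le> (L' + 2 * L' / e) * \<bar>u\<bar> ^ 3"
        using L' by (intro mult_right_mono) auto
      finally show ?thesis .
    qed
    show "\<bar>f t\<bar> \<le> L'" "\<bar>g t\<bar> \<le> L'" "\<bar>q t\<bar> \<le> L'" for t
      using fb[of t] bd[of t] qL[of t] L' by linarith+
    show "0 < L'" by fact
    show "g t = 0" if "t \<notin> {a<..<b}" for t
      using that by (intro out) auto
  qed (auto simp: q_def)
qed


section \<open>Stationary estimates for confined walks\<close>

context stationary_walk begin

text \<open>
  Diffusive scaling multiplies the generator by \<open>t\<^sup>2\<close>, which cancels from the Foster--Lyapunov bound.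
\<close>
lemma foster_lyapunov_scaled:
  assumes "t > 0" and f: "\<And>x. A * (x - c)\<^sup>2 - D \<le> f x" "A > 0"
    and int: "\<And>z. integrable (J z) (\<lambda>j. f (real_of_int (z + j) / t))"
    and gen: "\<And>z. t\<^sup>2 * generator (\<lambda>z. f (real_of_int z / t)) z \<le> a - r * indicator S z"
    and "0 \<le> a" "0 \<le> r"
  shows "r * measure p S \<le> a"
proof -
  have "r / t\<^sup>2 * measure p S \<le> a / t\<^sup>2"
  proof (rule foster_lyapunov)
    show "- D \<le> f (real_of_int z / t)" for z
    proof -
      have "0 \<le> A * (real_of_int z / t - c)\<^sup>2"
        using \<open>A > 0\<close> by simp
      then show ?thesis
        using f(1)[of "real_of_int z / t"] by linarith
    qed
    show "finite {z. f (real_of_int z / t) \<le> R}" for R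
      by (rule finite_sublevel_coercive[OF f \<open>t > 0\<close>])
    show "generator (\<lambda>z. f (real_of_int z / t)) z \<le> a / t\<^sup>2 - r / t\<^sup>2 * indicator S z" for z
      using gen[of z] \<open>t > 0\<close> by (simp add: field_simps)
  qed (use assms in auto)
  then show ?thesis
    using \<open>t > 0\<close> by (simp add: field_simps)
qed

end

text \<open>
  The scaled walk has drift \<open>- d\<close> inside \<open>(a, b)\<close>. Outside, a force towards the interval is added,
  which is at least \<open>T\<close> on the set \<open>Out\<close>. In general \<open>Out\<close> leaves a gap next to \<open>[a, b]\<close>, because the
  restoring force may be arbitrarily weak close to the end points; the mass there is estimated by
  curvature instead. The bound \<open>v\<close> rules out a degenerate variance on \<open>[- K, K]\<close>, and every point
  beyond \<open>K\<close> lies in \<open>Out\<close>.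
\<close>
locale confined_walk = stationary_walk +
  fixes a b K t d T v :: real and Out :: "real set"
  assumes t_pos: "t > 0" and endpoints: "- K \<le> a" "a \<le> b" "b \<le> K"
    and drift_inside: "real_of_int z / t \<in> {a<..<b} \<Longrightarrow> t * drift z = - d"
    and drift_right: "b \<le> real_of_int z / t \<Longrightarrow> t * drift z \<le> - d - T * indicator Out (real_of_int z / t)"
    and drift_left: "real_of_int z / t \<le> a \<Longrightarrow> - d + T * indicator Out (real_of_int z / t) \<le> t * drift z"
    and strong: "2 * \<bar>d\<bar> \<le> T"
    and Out_disjoint: "Out \<inter> {a<..<b} = {}"
    and Out_far: "x \<notin> Out \<Longrightarrow> \<bar>x\<bar> \<le> K"
    and second_moment_ge: "\<bar>real_of_int z / t\<bar> \<le> K \<Longrightarrow> v \<le> second_moment z"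
    and v_pos: "v > 0"
begin

text \<open>
  A slope \<open>G\<close> that points outwards outside the interval turns the drift into a Lyapunov bound: the
  restoring force contributes with a favourable sign, and at worst \<open>\<bar>d\<bar> * \<bar>G x\<bar>\<close> remains.
\<close>
lemma restoring_drift:
  fixes z :: int
  assumes "\<And>x. b \<le> x \<Longrightarrow> 0 \<le> G x" "\<And>x. x \<le> a \<Longrightarrow> G x \<le> 0"
  defines "x \<equiv> real_of_int z / t"
  shows "G x * (t * drift z) \<le> (\<bar>d\<bar> - T * indicator Out x) * \<bar>G x\<bar>"
proof -
  have d: "- d * G x \<le> \<bar>d\<bar> * \<bar>G x\<bar>"
    by (metis abs_ge_self abs_minus_cancel abs_mult)
  consider "x \<in> {a<..<b}" | "b \<le> x" | "x \<le> a" by force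
  then show ?thesis
  proof cases
    case 1
    then have "x \<notin> Out" using Out_disjoint by blast
    then show ?thesis
      using d drift_inside[of z] 1 unfolding x_def by (simp add: mult.commute)
  next
    case 2
    have "G x * (t * drift z) \<le> G x * (- d - T * indicator Out x)"
      using drift_right[of z] 2 assms(1)[OF 2] unfolding x_def by (intro mult_left_mono) auto
    also have "\<dots> = - d * G x - T * indicator Out x * \<bar>G x\<bar>"
      using assms(1)[OF 2] by (simp add: algebra_simps)
    finally show ?thesis
      using d by (simp add: left_diff_distrib)
  next
    case 3
    have "G x * (t * drift z) \<le> G x * (- d + T * indicator Out x)"
      using drift_left[of z] 3 assms(2)[OF 3] unfolding x_def by (intro mult_left_mono_neg) auto
    also have "\<dots> = - d * G x - T * indicator Out x * \<bar>G x\<bar>"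
      using assms(2)[OF 3] by (simp add: algebra_simps)
    finally show ?thesis
      using d by (simp add: left_diff_distrib)
  qed
qed

text \<open>
  Foster--Lyapunov bound with the parabola \<open>(x - c)\<^sup>2 / 2\<close>: on \<open>Out\<close> the force \<open>T\<close> beats \<open>\<bar>d\<bar>\<close> by a
  factor two, and off \<open>Out\<close> the walk is within \<open>K\<close> of the origin. As \<open>T\<close> grows, the mass of
  \<open>Out\<close> away from \<open>c\<close> vanishes.
\<close>
lemma mass_outside:
  assumes "a \<le> c" "c \<le> b" "r > 0"
  shows "T * r / 2 * measure p {z. real_of_int z / t \<in> Out \<and> r \<le> \<bar>real_of_int z / t - c\<bar>} \<le> 2 * K * \<bar>d\<bar> + C"
proof -
  define f where "f x = (x - c)\<^sup>2 / 2" for x :: real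
  have exact: "f (x + u) - f x - (x - c) * u = u\<^sup>2 / 2" for x u
    by (simp add: f_def power2_eq_square field_simps)
  have f2: "\<bar>f (x + u) - f x - (x - c) * u\<bar> \<le> 1 / 2 * u\<^sup>2" for x u
    unfolding exact by simp
  have Kd: "0 \<le> 2 * K * \<bar>d\<bar>"
    using endpoints by simp
  show ?thesis
  proof (rule foster_lyapunov_scaled)
    show "1 / 2 * (x - c)\<^sup>2 - 0 \<le> f x" for x
      by (simp add: f_def)
    show "integrable (J z) (\<lambda>j. f (real_of_int (z + j) / t))" for z
      by (rule generator_taylor2(1)[OF f2 t_pos])
    fix z
    define x where "x = real_of_int z / t"
    have "t\<^sup>2 * generator (\<lambda>z. f (real_of_int z / t)) z \<le> (x - c) * (t * drift z) + 1 / 2 * C"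
      using generator_taylor2(2)[OF f2 t_pos, of z] unfolding x_def by linarith
    also have "\<dots> \<le> (\<bar>d\<bar> - T * indicator Out x) * \<bar>x - c\<bar> + C"
      using restoring_drift[of "\<lambda>x. x - c" z] assms bound_nonneg unfolding x_def by fastforce
    also have "\<dots> \<le> 2 * K * \<bar>d\<bar> + C - T * r / 2 * indicator {z. real_of_int z / t \<in> Out \<and> r \<le> \<bar>real_of_int z / t - c\<bar>} z"
    proof (cases "x \<in> Out")
      case False
      then have "\<bar>x - c\<bar> \<le> 2 * K"
        using Out_far[OF False] endpoints assms by linarith
      then have "\<bar>d\<bar> * \<bar>x - c\<bar> \<le> \<bar>d\<bar> * (2 * K)"
        by (rule mult_left_mono) simp
      with False show ?thesis unfolding x_def by (simp add: mult.commute)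
    next
      case True
      have "(\<bar>d\<bar> - T) * \<bar>x - c\<bar> \<le> (- T / 2) * \<bar>x - c\<bar>"
        using strong by (intro mult_right_mono) auto
      moreover have "T / 2 * r \<le> T / 2 * \<bar>x - c\<bar>" if "r \<le> \<bar>x - c\<bar>"
        using that strong by (intro mult_left_mono) auto
      moreover have "0 \<le> T / 2 * \<bar>x - c\<bar>"
        using strong by simp
      ultimately have "(\<bar>d\<bar> - T) * \<bar>x - c\<bar> \<le> 2 * K * \<bar>d\<bar> - T * r / 2 * indicator {z. real_of_int z / t \<in> Out \<and> r \<le> \<bar>real_of_int z / t - c\<bar>} z"
        using Kd True unfolding x_def by (auto simp: indicator_def)
      with True show ?thesis by simp
    qed
    finally show "t\<^sup>2 * generator (\<lambda>z. f (real_of_int z / t)) z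
      \<le> 2 * K * \<bar>d\<bar> + C - T * r / 2 * indicator {z. real_of_int z / t \<in> Out \<and> r \<le> \<bar>real_of_int z / t - c\<bar>} z" .
  qed (use t_pos Kd bound_nonneg strong assms in auto)
qed

text \<open>
  Foster--Lyapunov bound with the rounded kink at \<open>y\<close>. The value of \<open>A\<close> makes the slope of the
  parabola equal to \<open>2\<close> in absolute value at the end points, which dominates the arctangent there. Once
  \<open>t \<ge> 1 / e\<^sup>2\<close>, the right-hand side is bounded independently of \<open>e\<close>, so the mass of the
  \<open>e\<close>-neighbourhood of \<open>y\<close> is of order \<open>e\<close>, even if \<open>y\<close> is an end point.
\<close>
lemma mass_near_point:
  assumes "a < b" "y \<in> {a..b}" "e > 0"
  defines "A \<equiv> 4 / (b - a)"
  shows "v / (4 * e) * measure p {z. \<bar>real_of_int z / t - y\<bar> \<le> e \<and> \<bar>real_of_int z / t\<bar> \<le> K}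
       \<le> \<bar>d\<bar> * (2 * K * A + 2) + A * C / 2 + C / (e\<^sup>2 * t)"
proof -
  define c where "c = (a + b) / 2"
  have "A > 0" using \<open>a < b\<close> by (simp add: A_def)
  have c: "A * (b - c) = 2" "A * (a - c) = - 2"
    using \<open>a < b\<close> by (simp_all add: A_def c_def field_simps)
  have c_bounds: "a \<le> c" "c \<le> b"
    using \<open>a < b\<close> by (simp_all add: c_def)
  define f where "f = concentration_test A c e y"
  define G where "G = concentration_slope A c e y"
  define q where "q = concentration_curvature A e y"
  define S where "S = {z. \<bar>real_of_int z / t - y\<bar> \<le> e \<and> \<bar>real_of_int z / t\<bar> \<le> K}"
  have f2: "\<bar>f (x + u) - f x - G x * u\<bar> \<le> (A + 1 / e) * u\<^sup>2" for x u
    unfolding f_def G_def using assms \<open>A > 0\<close> by (intro concentration_test_taylor2) auto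
  have f3: "\<bar>f (x + u) - f x - G x * u - q x * u\<^sup>2 / 2\<bar> \<le> 1 / e\<^sup>2 * \<bar>u\<bar> ^ 3" for x u
    unfolding f_def G_def q_def using assms by (intro concentration_test_taylor3) auto
  have at: "\<bar>arctan x\<bar> \<le> 2" for x
    using arctan_bounded[of x] pi_less_4 by auto
  have Gr: "0 \<le> G x" if "b \<le> x" for x
  proof -
    have "2 \<le> A * (x - c)"
      using mult_left_mono[of "b - c" "x - c" A] that \<open>A > 0\<close> c by simp
    with at[of "(x - y) / e"] show ?thesis
      unfolding G_def concentration_slope_def by linarith
  qed
  have Gl: "G x \<le> 0" if "x \<le> a" for x
  proof -
    have "A * (x - c) \<le> - 2"
      using mult_left_mono[of "x - c" "a - c" A] that \<open>A > 0\<close> c by simp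
    with at[of "(x - y) / e"] show ?thesis
      unfolding G_def concentration_slope_def by linarith
  qed
  have "v / (4 * e) * measure p S \<le> \<bar>d\<bar> * (2 * K * A + 2) + A * C / 2 + C / (e\<^sup>2 * t)"
  proof (rule foster_lyapunov_scaled)
    show "A / 4 * (x - c)\<^sup>2 - (4 / A + 2 * \<bar>c - y\<bar>) \<le> f x" for x
      unfolding f_def using \<open>A > 0\<close> assms by (intro concentration_test_coercive) auto
    show "integrable (J z) (\<lambda>j. f (real_of_int (z + j) / t))" for z
      by (rule generator_taylor2(1)[OF f2 t_pos])
    fix z
    define x where "x = real_of_int z / t"
    have "t\<^sup>2 * generator (\<lambda>z. f (real_of_int z / t)) z
        \<le> G x * (t * drift z) + q x * second_moment z / 2 + 1 / e\<^sup>2 * C / t"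
      using generator_taylor3[OF f2 t_pos f3, of z] unfolding x_def by (simp add: abs_le_iff)
    moreover have "G x * (t * drift z) \<le> \<bar>d\<bar> * (2 * K * A + 2)"
    proof -
      have "G x * (t * drift z) \<le> (\<bar>d\<bar> - T * indicator Out x) * \<bar>G x\<bar>"
        using restoring_drift[of G z, OF Gr Gl] unfolding x_def by simp
      also have "\<dots> \<le> \<bar>d\<bar> * (2 * K * A + 2)"
      proof (cases "x \<in> Out")
        case False
        have "\<bar>x - c\<bar> \<le> 2 * K"
          using Out_far[OF False] endpoints c_bounds by linarith
        then have "A * \<bar>x - c\<bar> \<le> A * (2 * K)"
          using \<open>A > 0\<close> by (intro mult_left_mono) auto
        moreover have "\<bar>G x\<bar> \<le> \<bar>A * (x - c)\<bar> + \<bar>arctan ((x - y) / e)\<bar>"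
          unfolding G_def concentration_slope_def by (rule abs_triangle_ineq4)
        moreover have "\<bar>A * (x - c)\<bar> = A * \<bar>x - c\<bar>"
          using \<open>A > 0\<close> by (simp add: abs_mult)
        ultimately have "\<bar>G x\<bar> \<le> 2 * K * A + 2"
          using at[of "(x - y) / e"] by (simp add: mult_ac)
        with False show ?thesis
          by (simp add: mult_left_mono)
      next
        case True
        have "(\<bar>d\<bar> - T) * \<bar>G x\<bar> \<le> 0"
          using strong by (intro mult_nonpos_nonneg) auto
        moreover have "0 \<le> \<bar>d\<bar> * (2 * K * A + 2)"
          using endpoints \<open>A > 0\<close> by simp
        ultimately show ?thesis using True by simp
      qed
      finally show ?thesis .
    qed
    moreover have "q x * second_moment z / 2 \<le> A * C / 2 - v / (4 * e) * indicator S z"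
    proof -
      let ?w = "1 / (e * (1 + ((x - y) / e)\<^sup>2))"
      have pos: "0 < e * (1 + ((x - y) / e)\<^sup>2)"
        using \<open>e > 0\<close> by (intro mult_pos_pos add_pos_nonneg) auto
      have "v / (2 * e) * indicator S z \<le> ?w * second_moment z"
      proof (cases "z \<in> S")
        case False
        then show ?thesis using pos second_moment_nonneg[of z] by simp
      next
        case True
        then have "v \<le> second_moment z"
          unfolding S_def using second_moment_ge by blast
        have "\<bar>(x - y) / e\<bar> \<le> 1"
          using True \<open>e > 0\<close> unfolding S_def x_def by simp
        then have "((x - y) / e)\<^sup>2 \<le> 1"
          by (simp only: abs_le_square_iff[of _ 1, simplified])
        then have "e * (1 + ((x - y) / e)\<^sup>2) \<le> e * 2"
          using \<open>e > 0\<close> by (intro mult_left_mono) auto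
        then have "1 / (2 * e) \<le> ?w"
          using pos by (intro divide_left_mono) (auto simp: mult.commute)
        then have "1 / (2 * e) * v \<le> ?w * second_moment z"
          using \<open>v \<le> second_moment z\<close> v_pos \<open>e > 0\<close> pos by (intro mult_mono) auto
        with True show ?thesis by simp
      qed
      moreover have "A * second_moment z \<le> A * C"
        using second_moment_le \<open>A > 0\<close> by (intro mult_left_mono) auto
      moreover have "q x * second_moment z = A * second_moment z - ?w * second_moment z"
        unfolding q_def concentration_curvature_def by (simp add: left_diff_distrib)
      ultimately show ?thesis by (simp add: field_simps)
    qed
    ultimately show "t\<^sup>2 * generator (\<lambda>z. f (real_of_int z / t)) z
        \<le> \<bar>d\<bar> * (2 * K * A + 2) + A * C / 2 + C / (e\<^sup>2 * t) - v / (4 * e) * indicator S z"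
      by simp
  qed (use t_pos \<open>A > 0\<close> bound_nonneg endpoints v_pos assms in auto)
  then show ?thesis unfolding S_def .
qed

text \<open>
  Testing the stationary law against the Stein solution. Away from the kinks the scaled generator
  equals \<open>1{x \<le> x0} - F\<close> inside the interval and \<open>0\<close> outside, up to the Taylor error \<open>Q * C / t\<close> and the
  variance error \<open>\<kappa>\<close>; the restoring force outside the interval drops out because \<open>g\<close> vanishes
  there. Near the kinks the generator is merely bounded, which costs the mass of their
  \<open>e\<close>-neighbourhoods.
\<close>
lemma stein_estimate:
  assumes "a < b" "x0 \<in> {a<..<b}" "s > 0" "0 \<le> F" "F \<le> 1" "e > 0"
    and f: "\<And>x. \<bar>f x\<bar> \<le> L" "\<And>x. \<bar>g x\<bar> \<le> L" "\<And>x. \<bar>q x\<bar> \<le> L"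
    and f2: "\<And>x u. \<bar>f (x + u) - f x - g x * u\<bar> \<le> L * u\<^sup>2"
    and out: "\<And>x. x \<notin> {a<..<b} \<Longrightarrow> g x = 0" "\<And>x. x \<notin> {a<..<b} \<Longrightarrow> q x = 0"
    and ode: "\<And>x. x \<in> {a<..<b} \<Longrightarrow> q x = 2 / s * ((if x \<le> x0 then 1 else 0) - F) + 2 * d / s * g x"
    and f3: "\<And>x u. (\<And>y. y \<in> {a, x0, b} \<Longrightarrow> e < \<bar>x - y\<bar>) \<Longrightarrow>
       \<bar>f (x + u) - f x - g x * u - q x * u\<^sup>2 / 2\<bar> \<le> Q * \<bar>u\<bar> ^ 3"
    and var: "\<And>z. real_of_int z / t \<in> {a<..<b} \<Longrightarrow> \<bar>second_moment z - s\<bar> \<le> \<kappa>"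
    and "0 \<le> Q" "0 \<le> \<kappa>"
  shows "\<bar>measure p {z. real_of_int z / t \<in> {a<..<b} \<and> real_of_int z / t \<le> x0}
          - F * measure p {z. real_of_int z / t \<in> {a<..<b}}\<bar>
       \<le> Q * C / t + L * \<kappa> / 2
          + (L * C + L * \<bar>d\<bar> + 1) * measure p {z. \<exists>y\<in>{a, x0, b}. \<bar>real_of_int z / t - y\<bar> \<le> e}"
proof -
  define I where "I = {z. real_of_int z / t \<in> {a<..<b}}"
  define H where "H = {z. real_of_int z / t \<in> {a<..<b} \<and> real_of_int z / t \<le> x0}"
  define Z where "Z = {z. \<exists>y\<in>{a, x0, b}. \<bar>real_of_int z / t - y\<bar> \<le> e}"
  let ?L = "\<lambda>z. t\<^sup>2 * generator (\<lambda>z. f (real_of_int z / t)) z"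
  let ?h = "\<lambda>z. indicator H z - F * indicator I z :: real"
  let ?B = "L * C + L * \<bar>d\<bar> + 1"
  have "0 \<le> L" using f(1)[of 0] by linarith
  have h1: "\<bar>?h z\<bar> \<le> 1" for z
    using assms(4,5) by (auto simp: indicator_def H_def I_def)
  have Lb: "\<bar>?L z\<bar> \<le> t\<^sup>2 * (2 * L)" for z
    using abs_generator_bounded[of "\<lambda>z. f (real_of_int z / t)" L z] f(1)
    by (simp add: abs_mult mult_left_mono)
  have err: "\<bar>?h z - ?L z\<bar> \<le> Q * C / t + L * \<kappa> / 2 + ?B * indicator Z z" for z
  proof -
    define x where "x = real_of_int z / t"
    have nn: "0 \<le> Q * C / t" "0 \<le> L * \<kappa> / 2"
      using \<open>0 \<le> Q\<close> bound_nonneg t_pos \<open>0 \<le> L\<close> \<open>0 \<le> \<kappa>\<close> by simp_all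
    have gd: "\<bar>g x * (t * drift z)\<bar> \<le> L * \<bar>d\<bar>"
    proof (cases "x \<in> {a<..<b}")
      case True
      then show ?thesis
        using drift_inside[of z] f(2)[of x] unfolding x_def by (simp add: abs_mult mult_right_mono)
    next
      case False
      then show ?thesis using out(1)[OF False] \<open>0 \<le> L\<close> by simp
    qed
    show ?thesis
    proof (cases "z \<in> Z")
      case True
      have "\<bar>?L z - g x * (t * drift z)\<bar> \<le> L * C"
        using generator_taylor2(2)[OF f2 t_pos, of z] unfolding x_def .
      then have "\<bar>?h z - ?L z\<bar> \<le> ?B"
        using gd h1[of z] by linarith
      with True nn show ?thesis by simp
    next
      case False
      then have far: "e < \<bar>x - y\<bar>" if "y \<in> {a, x0, b}" for y
        using that unfolding Z_def x_def by force
      have main: "\<bar>?L z - (g x * (t * drift z) + q x * second_moment z / 2)\<bar> \<le> Q * C / t"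
        using generator_taylor3[OF f2 t_pos f3, of z] far unfolding x_def by simp
      show ?thesis
      proof (cases "x \<in> {a<..<b}")
        case in_ab: True
        then have z: "indicator I z = (1::real)" "indicator H z = (if x \<le> x0 then 1 else 0 :: real)"
          unfolding I_def H_def x_def by auto
        have "q x * s / 2 = ?h z + d * g x"
          unfolding ode[OF in_ab] z using \<open>s > 0\<close> by (simp add: field_simps)
        moreover have "t * drift z = - d"
          using drift_inside[of z] in_ab unfolding x_def by simp
        ultimately have eq: "?h z = g x * (t * drift z) + q x * second_moment z / 2
            - q x * (second_moment z - s) / 2"
          by (simp add: field_simps)
        have "\<bar>q x * (second_moment z - s)\<bar> \<le> L * \<kappa>"
          unfolding abs_mult using f(3)[of x] var[of z] in_ab \<open>0 \<le> L\<close>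
          unfolding x_def by (intro mult_mono) auto
        then show ?thesis
          using False main unfolding eq by (simp add: abs_le_iff)
      next
        case out_ab: False
        then have "?h z = 0"
          unfolding I_def H_def x_def by auto
        then show ?thesis
          using False main nn out[OF out_ab] by simp
      qed
    qed
  qed
  have int: "integrable p ?h" "integrable p ?L"
    by (rule bounded_integrable[OF h1]) (rule bounded_integrable[OF Lb])
  have iI: "integrable p (indicator X :: int \<Rightarrow> real)" for X
    by (rule bounded_integrable[where R = 1]) (auto split: split_indicator)
  have "measure_pmf.expectation p ?L = 0"
    using expectation_generator_bounded[of "\<lambda>z. f (real_of_int z / t)" L] f(1) by simp
  moreover have "measure_pmf.expectation p ?h = measure p H - F * measure p I"
    using iI[of H] iI[of I] by simp
  ultimately have "\<bar>measure p H - F * measure p I\<bar> = \<bar>measure_pmf.expectation p (\<lambda>z. ?h z - ?L z)\<bar>"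
    using t_pos by (subst Bochner_Integration.integral_diff[OF int]) simp
  also have "\<dots> \<le> measure_pmf.expectation p (\<lambda>z. \<bar>?h z - ?L z\<bar>)"
    by (rule integral_abs_bound)
  also have "\<dots> \<le> measure_pmf.expectation p (\<lambda>z. Q * C / t + L * \<kappa> / 2 + ?B * indicator Z z)"
    using err int iI[of Z] by (intro integral_mono) auto
  also have "\<dots> = Q * C / t + L * \<kappa> / 2 + ?B * measure p Z"
    using iI[of Z] by simp
  finally show ?thesis
    unfolding H_def I_def Z_def .
qed

end


section \<open>The imbalance as a stationary walk\<close>

context matching_queue begin

lemma arrivals_measurable [measurable]:
  "ac z k \<in> N \<rightarrow>\<^sub>M count_space UNIV" "as z k \<in> N \<rightarrow>\<^sub>M count_space UNIV"
proof -
  have "case_sum (\<lambda>(z, k). ac z k) (\<lambda>(z, k). as z k) i \<in> N \<rightarrow>\<^sub>M count_space UNIV" for i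
    using independent unfolding indep_vars_def by auto
  from this[of "Inl (z, k)"] this[of "Inr (z, k)"]
  show "ac z k \<in> N \<rightarrow>\<^sub>M count_space UNIV" "as z k \<in> N \<rightarrow>\<^sub>M count_space UNIV"
    by simp_all
qed

lemma real_arrivals_measurable [measurable]:
  "(\<lambda>w. real (ac z k w)) \<in> borel_measurable N" "(\<lambda>w. real (as z k w)) \<in> borel_measurable N"
  by measurable

definition jump :: "int \<Rightarrow> 'w \<Rightarrow> int" where
  "jump z w = int (ac z 0 w) - int (as z 0 w)"

lemma jump_measurable [measurable]: "jump z \<in> N \<rightarrow>\<^sub>M count_space UNIV"
  unfolding jump_def by measurable

text \<open>
  The law of the increment from state \<open>z\<close>; the variables with time index \<open>0\<close> are the generic copies.
\<close>
definition jump_pmf :: "int \<Rightarrow> int pmf" where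
  "jump_pmf z = Abs_pmf (distr N (count_space UNIV) (jump z))"

lemma measure_jump_pmf: "measure_pmf (jump_pmf z) = distr N (count_space UNIV) (jump z)"
  unfolding jump_pmf_def by (intro measure_pmf_Abs_pmf prob_space_distr) auto

lemma expectation_jump_pmf:
  fixes h :: "int \<Rightarrow> real"
  shows "measure_pmf.expectation (jump_pmf z) h = expectation (\<lambda>w. h (jump z w))"
  unfolding measure_jump_pmf by (rule integral_distr) auto

lemma integrable_jump_pmf:
  fixes h :: "int \<Rightarrow> real"
  shows "integrable (jump_pmf z) h \<longleftrightarrow> integrable N (\<lambda>w. h (jump z w))"
  unfolding measure_jump_pmf by (rule integrable_distr_eq) auto

lemma prob_jump_pmf: "measure (jump_pmf z) A = prob {w \<in> space N. jump z w \<in> A}"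
  unfolding measure_jump_pmf by (subst measure_distr) (auto simp: vimage_def Int_def conj_commute)

lemma nat_power_le_cube:
  fixes n :: nat
  shows "real n \<le> real n ^ 3" "(real n)\<^sup>2 \<le> real n ^ 3"
  using integer_power_le_cube[of "int n"] by simp_all

lemma moments_integrable:
  "integrable N (\<lambda>w. real (ac z 0 w))" "integrable N (\<lambda>w. real (as z 0 w))"
  "integrable N (\<lambda>w. (real (ac z 0 w))\<^sup>2)" "integrable N (\<lambda>w. (real (as z 0 w))\<^sup>2)"
  "integrable N (\<lambda>w. real (ac z 0 w) ^ 3)" "integrable N (\<lambda>w. real (as z 0 w) ^ 3)"
proof -
  show c: "integrable N (\<lambda>w. real (ac z 0 w) ^ 3)" and s: "integrable N (\<lambda>w. real (as z 0 w) ^ 3)"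
    using integrable_c[of z] integrable_s[of z] by simp_all
  show "integrable N (\<lambda>w. real (ac z 0 w))" "integrable N (\<lambda>w. (real (ac z 0 w))\<^sup>2)"
    by (rule Bochner_Integration.integrable_bound[OF c]; use nat_power_le_cube in auto)+
  show "integrable N (\<lambda>w. real (as z 0 w))" "integrable N (\<lambda>w. (real (as z 0 w))\<^sup>2)"
    by (rule Bochner_Integration.integrable_bound[OF s]; use nat_power_le_cube in auto)+
qed

lemma abs_jump_cube_le: "\<bar>real_of_int (jump z w)\<bar> ^ 3 \<le> real (ac z 0 w) ^ 3 + real (as z 0 w) ^ 3"
proof -
  have "\<bar>real_of_int (jump z w)\<bar> \<le> max (real (ac z 0 w)) (real (as z 0 w))"
    by (simp add: jump_def)
  then have "\<bar>real_of_int (jump z w)\<bar> ^ 3 \<le> max (real (ac z 0 w)) (real (as z 0 w)) ^ 3"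
    by (rule power_mono) simp
  also have "\<dots> \<le> real (ac z 0 w) ^ 3 + real (as z 0 w) ^ 3"
    by (simp add: max_def)
  finally show ?thesis .
qed

lemma jump_cube_integrable: "integrable N (\<lambda>w. \<bar>real_of_int (jump z w)\<bar> ^ 3)"
  by (rule Bochner_Integration.integrable_bound[where f = "\<lambda>w. real (ac z 0 w) ^ 3 + real (as z 0 w) ^ 3"])
     (use moments_integrable abs_jump_cube_le in auto)

lemma jump_cube_bound: "expectation (\<lambda>w. \<bar>real_of_int (jump z w)\<bar> ^ 3) \<le> 2 * M"
proof -
  have "expectation (\<lambda>w. \<bar>real_of_int (jump z w)\<bar> ^ 3)
      \<le> expectation (\<lambda>w. real (ac z 0 w) ^ 3 + real (as z 0 w) ^ 3)"
    by (rule integral_mono) (use jump_cube_integrable moments_integrable abs_jump_cube_le in auto)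
  also have "\<dots> \<le> 2 * M"
    using third_moment_c[of z] third_moment_s[of z] moments_integrable by simp
  finally show ?thesis .
qed

lemma expectation_jump: "expectation (\<lambda>w. real_of_int (jump z w)) = lam z - mu z"
  unfolding jump_def using moments_integrable mean_c[of z] mean_s[of z] by simp

text \<open>
  Independence makes the two arrival numbers of one slot uncorrelated, so that their variances add up
  to that of the jump.
\<close>
lemma expectation_arrivals_product:
  "expectation (\<lambda>w. real (ac z 0 w) * real (as z 0 w)) = lam z * mu z"
  "integrable N (\<lambda>w. real (ac z 0 w) * real (as z 0 w))"
proof -
  let ?X = "\<lambda>i w. real (case_sum (\<lambda>(z, k). ac z k) (\<lambda>(z, k). as z k) i w)"
  have "indep_vars (\<lambda>_. borel) (\<lambda>i. real \<circ> case_sum (\<lambda>(z, k). ac z k) (\<lambda>(z, k). as z k) i) UNIV"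
    by (rule indep_vars_compose[OF independent]) auto
  then have ind: "indep_vars (\<lambda>_. borel) ?X {Inl (z, 0), Inr (z, 0)}"
    unfolding comp_def by (rule indep_vars_subset) auto
  have int: "integrable N (?X i)" if "i \<in> {Inl (z, 0), Inr (z, 0)}" for i
    using that moments_integrable by auto
  show "expectation (\<lambda>w. real (ac z 0 w) * real (as z 0 w)) = lam z * mu z"
    using indep_vars_lebesgue_integral[OF _ ind int] mean_c[of z] mean_s[of z] by simp
  show "integrable N (\<lambda>w. real (ac z 0 w) * real (as z 0 w))"
    using indep_vars_integrable[OF _ ind int] by simp
qed

lemma expectation_jump_square:
  "expectation (\<lambda>w. (real_of_int (jump z w))\<^sup>2) = \<sigma>c (lam z) + \<sigma>s (mu z) + (lam z - mu z)\<^sup>2"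
proof -
  have c: "expectation (\<lambda>w. (real (ac z 0 w))\<^sup>2) = \<sigma>c (lam z) + (lam z)\<^sup>2"
    using variance_c[of z] by (subst (asm) variance_eq) (use moments_integrable mean_c in auto)
  have s: "expectation (\<lambda>w. (real (as z 0 w))\<^sup>2) = \<sigma>s (mu z) + (mu z)\<^sup>2"
    using variance_s[of z] by (subst (asm) variance_eq) (use moments_integrable mean_s in auto)
  have "expectation (\<lambda>w. (real_of_int (jump z w))\<^sup>2)
      = expectation (\<lambda>w. (real (ac z 0 w))\<^sup>2 + (real (as z 0 w))\<^sup>2 - 2 * (real (ac z 0 w) * real (as z 0 w)))"
    by (simp add: jump_def power2_diff mult.assoc)
  also have "\<dots> = \<sigma>c (lam z) + (lam z)\<^sup>2 + (\<sigma>s (mu z) + (mu z)\<^sup>2) - 2 * (lam z * mu z)"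
    using moments_integrable expectation_arrivals_product c s by simp
  finally show ?thesis
    by (simp add: power2_diff)
qed

text \<open>
  A nonzero integer has square at least \<open>1\<close>, so jumps with probability \<open>\<pi>\<close> in either direction keep
  the second moment away from \<open>0\<close>.
\<close>
lemma jump_square_ge:
  assumes "prob {w \<in> space N. ac z 0 w > as z 0 w} \<ge> \<pi>" "prob {w \<in> space N. ac z 0 w < as z 0 w} \<ge> \<pi>"
  shows "2 * \<pi> \<le> expectation (\<lambda>w. (real_of_int (jump z w))\<^sup>2)"
proof -
  let ?U = "{w \<in> space N. ac z 0 w > as z 0 w}" and ?D = "{w \<in> space N. ac z 0 w < as z 0 w}"
  have "{w \<in> space N. real (ac z 0 w) > real (as z 0 w)} \<in> events"
    "{w \<in> space N. real (ac z 0 w) < real (as z 0 w)} \<in> events"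
    by measurable
  then have [measurable]: "?U \<in> events" "?D \<in> events" by simp_all
  have "2 * \<pi> \<le> prob ?U + prob ?D"
    using assms by simp
  also have "\<dots> = expectation (\<lambda>w. indicator ?U w + indicator ?D w)"
    by (subst Bochner_Integration.integral_add) (auto intro!: integrable_real_indicator simp: emeasure_eq_measure)
  also have "\<dots> \<le> expectation (\<lambda>w. (real_of_int (jump z w))\<^sup>2)"
  proof (rule integral_mono)
    show "integrable N (\<lambda>w. indicator ?U w + indicator ?D w :: real)"
      by (auto intro!: integrable_real_indicator Bochner_Integration.integrable_add simp: emeasure_eq_measure)
    show "integrable N (\<lambda>w. (real_of_int (jump z w))\<^sup>2)"
      using moments_integrable expectation_arrivals_product(2)[of z]
      by (simp add: jump_def power2_diff mult.assoc)
    show "indicator ?U w + indicator ?D w \<le> (real_of_int (jump z w))\<^sup>2" for w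
    proof (cases "jump z w = 0")
      case True
      then show ?thesis by (auto simp: jump_def indicator_def)
    next
      case False
      then have "1 \<le> (jump z w)\<^sup>2"
        by (metis int_one_le_iff_zero_less zero_less_power2)
      then have "(1::real) \<le> (real_of_int (jump z w))\<^sup>2"
        by (metis of_int_1_le_iff of_int_power)
      then show ?thesis by (auto simp: indicator_def)
    qed
  qed
  finally show ?thesis .
qed

text \<open>
  The state after one step from \<open>x\<close> is \<open>x\<close> plus the jump, so the balance equations say that \<open>D\<close> is
  invariant under one step of the walk.
\<close>
lemma balance_imp_bind_pmf:
  assumes "stationary_distribution N (imbalance ac as) D"
  shows "bind_pmf (Abs_pmf D) (\<lambda>z. map_pmf (\<lambda>j. z + j) (jump_pmf z)) = Abs_pmf D"
proof (rule pmf_eqI)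
  fix y
  define p where "p = Abs_pmf D"
  have pD: "measure_pmf p = D"
    using assms unfolding stationary_distribution_def p_def by (intro measure_pmf_Abs_pmf) auto
  let ?P = "\<lambda>x. prob {w \<in> space N. imbalance ac as x 1 w = y}"
  have step: "pmf (map_pmf (\<lambda>j. x + j) (jump_pmf x)) y = ?P x" for x
    by (simp add: pmf_map prob_jump_pmf jump_def vimage_def add_diff_eq)
  have "((\<lambda>x. pmf p x * ?P x) has_sum pmf p y) UNIV"
    using assms unfolding stationary_distribution_def by (simp add: pD[symmetric] pmf.rep_eq)
  then have "infsum (\<lambda>x. pmf p x * ?P x) UNIV = pmf p y"
    by (rule infsumI)
  moreover have "Infinite_Set_Sum.abs_summable_on (\<lambda>x. pmf p x * ?P x) UNIV"
    by (rule abs_summable_on_comparison_test'[OF pmf_abs_summable[of p]])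
       (simp add: abs_mult mult_left_le)
  ultimately have "pmf p y = infsetsum (\<lambda>x. pmf p x * ?P x) UNIV"
    by (simp add: infsetsum_infsum)
  also have "\<dots> = measure_pmf.expectation p ?P"
    by (rule pmf_expectation_eq_infsetsum[symmetric])
  finally show "pmf (bind_pmf p (\<lambda>z. map_pmf (\<lambda>j. z + j) (jump_pmf z))) y = pmf p y"
    by (simp add: pmf_bind step)
qed

lemma stationary_walk:
  assumes "stationary_distribution N (imbalance ac as) D"
  shows "stationary_walk (Abs_pmf D) jump_pmf (2 * M)"
proof
  show "bind_pmf (Abs_pmf D) (\<lambda>z. map_pmf (\<lambda>j. z + j) (jump_pmf z)) = Abs_pmf D"
    by (rule balance_imp_bind_pmf[OF assms])
qed (simp_all add: integrable_jump_pmf expectation_jump_pmf jump_cube_integrable jump_cube_bound)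

end


section \<open>Limit laws of confined walks\<close>

text \<open>
  A family of confined walks with scale \<open>t\<close> tending to infinity and a common net drift curve \<open>\<phi>\<close>,
  whose zero set has end points \<open>a\<close> and \<open>b\<close>. At each small level \<open>c\<close> the walks are eventually confined with
  respect to the set where \<open>\<phi>\<close> is at least \<open>c\<close> in absolute value, and the force on it diverges.
  The case \<open>a = b\<close> is included.
\<close>
locale confined_family =
  fixes p :: "'i \<Rightarrow> int pmf" and J :: "'i \<Rightarrow> int \<Rightarrow> int pmf" and C a b K d v \<delta> s :: real
    and t \<kappa> :: "'i \<Rightarrow> real" and T :: "real \<Rightarrow> 'i \<Rightarrow> real" and \<phi> :: "real \<Rightarrow> real" and F :: "'i filter"
  assumes confined: "0 < c \<Longrightarrow> c \<le> \<delta> \<Longrightarrow>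
      \<forall>\<^sub>F i in F. confined_walk (p i) (J i) C a b K (t i) d (T c i) v {x. c \<le> \<bar>\<phi> x\<bar>}"
    and t_top: "filterlim t at_top F"
    and T_top: "0 < c \<Longrightarrow> filterlim (T c) at_top F"
    and \<delta>_pos: "0 < \<delta>"
    and order: "- K \<le> a" "a \<le> b" "b \<le> K" "0 < v"
    and \<phi>_antimono: "antimono \<phi>"
    and \<phi>_right: "b < x \<Longrightarrow> \<phi> x < 0" and \<phi>_left: "x < a \<Longrightarrow> 0 < \<phi> x"
    and \<phi>_far: "K < \<bar>x\<bar> \<Longrightarrow> \<delta> \<le> \<bar>\<phi> x\<bar>"
    and variance: "\<forall>\<^sub>F i in F. \<forall>z. real_of_int z / t i \<in> {a<..<b} \<longrightarrow>
          \<bar>stationary_walk.second_moment (J i) z - s\<bar> \<le> \<kappa> i"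
    and \<kappa>_zero: "(\<kappa> \<longlongrightarrow> 0) F"
    and s_pos: "0 < s"
begin

abbreviation Prob :: "'i \<Rightarrow> (real \<Rightarrow> bool) \<Rightarrow> real" where
  "Prob i P \<equiv> measure (p i) {z. P (real_of_int z / t i)}"

lemma Prob_mono: "(\<And>x. P x \<Longrightarrow> Q x) \<Longrightarrow> Prob i P \<le> Prob i Q"
  by (rule measure_pmf.finite_measure_mono) auto

lemma Prob_disj: "Prob i (\<lambda>x. P x \<or> Q x) \<le> Prob i P + Prob i Q"
  using measure_Un_le[of "{z. P (real_of_int z / t i)}" "p i" "{z. Q (real_of_int z / t i)}"]
  by (simp add: Collect_disj_eq)

lemma eventually_confined:
  "\<forall>\<^sub>F i in F. confined_walk (p i) (J i) C a b K (t i) d (T \<delta> i) v {x. \<delta> \<le> \<bar>\<phi> x\<bar>}"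
  using confined[of \<delta>] \<delta>_pos by simp

lemma mass_outside_tendsto:
  assumes "0 < c" "c \<le> \<delta>" "a \<le> m" "m \<le> b" "0 < r"
  shows "((\<lambda>i. Prob i (\<lambda>x. c \<le> \<bar>\<phi> x\<bar> \<and> r \<le> \<bar>x - m\<bar>)) \<longlongrightarrow> 0) F"
proof (rule tendsto_sandwich[OF _ _ tendsto_const])
  let ?B = "2 * (2 * K * \<bar>d\<bar> + C) / r"
  show "((\<lambda>i. ?B / T c i) \<longlongrightarrow> 0) F"
    by (rule tendsto_divide_0[OF tendsto_const]) (rule filterlim_at_top_imp_at_infinity[OF T_top[OF \<open>0 < c\<close>]])
  have "\<forall>\<^sub>F i in F. 1 \<le> T c i"
    using T_top[OF \<open>0 < c\<close>] by (simp add: filterlim_at_top)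
  with confined[OF assms(1,2)]
  show "\<forall>\<^sub>F i in F. Prob i (\<lambda>x. c \<le> \<bar>\<phi> x\<bar> \<and> r \<le> \<bar>x - m\<bar>) \<le> ?B / T c i"
  proof eventually_elim
    case (elim i)
    then show ?case
      using confined_walk.mass_outside[OF elim(1) assms(3-5)] \<open>0 < r\<close>
      by (simp add: field_simps)
  qed
qed auto

text \<open>
  By monotonicity \<open>\<phi>\<close> is bounded away from \<open>0\<close> at distance \<open>e\<close> from the interval, so such points
  belong to a set of positive level.
\<close>
lemma mass_far_tendsto:
  assumes "0 < e"
  shows "((\<lambda>i. Prob i (\<lambda>x. x \<le> a - e \<or> b + e \<le> x)) \<longlongrightarrow> 0) F"
proof (rule tendsto_sandwich[OF _ _ tendsto_const])
  define c where "c = min \<delta> (min \<bar>\<phi> (a - e)\<bar> \<bar>\<phi> (b + e)\<bar>)"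
  define m where "m = (a + b) / 2"
  have signs: "0 < \<phi> (a - e)" "\<phi> (b + e) < 0"
    using \<phi>_left[of "a - e"] \<phi>_right[of "b + e"] assms by auto
  then have "0 < c" "c \<le> \<delta>"
    using \<delta>_pos by (auto simp: c_def)
  moreover have "a \<le> m" "m \<le> b"
    using order by (auto simp: m_def)
  moreover have "0 < (b - a) / 2 + e"
    using order assms by (intro add_nonneg_pos) auto
  ultimately show "((\<lambda>i. Prob i (\<lambda>x. c \<le> \<bar>\<phi> x\<bar> \<and> (b - a) / 2 + e \<le> \<bar>x - m\<bar>)) \<longlongrightarrow> 0) F"
    by (rule mass_outside_tendsto)
  show "\<forall>\<^sub>F i in F. Prob i (\<lambda>x. x \<le> a - e \<or> b + e \<le> x)
      \<le> Prob i (\<lambda>x. c \<le> \<bar>\<phi> x\<bar> \<and> (b - a) / 2 + e \<le> \<bar>x - m\<bar>)"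
  proof (intro always_eventually allI Prob_mono)
    fix x assume x: "x \<le> a - e \<or> b + e \<le> x"
    then have "\<phi> (a - e) \<le> \<phi> x \<or> \<phi> x \<le> \<phi> (b + e)"
      using \<phi>_antimono by (auto dest: antimonoD)
    then have "c \<le> \<bar>\<phi> x\<bar>"
      using signs by (auto simp: c_def)
    moreover have "m - (b - a) / 2 = a" "m + (b - a) / 2 = b"
      by (simp_all add: m_def field_simps)
    with x have "(b - a) / 2 + e \<le> \<bar>x - m\<bar>"
      by linarith
    ultimately show "c \<le> \<bar>\<phi> x\<bar> \<and> (b - a) / 2 + e \<le> \<bar>x - m\<bar>" ..
  qed
qed auto

lemma mass_beyond_K_tendsto:
  assumes "a < b"
  shows "((\<lambda>i. Prob i (\<lambda>x. K < \<bar>x\<bar>)) \<longlongrightarrow> 0) F"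
proof (rule tendsto_sandwich[OF _ _ tendsto_const])
  define m where "m = (a + b) / 2"
  have m: "m - (b - a) / 2 = a" "m + (b - a) / 2 = b"
    by (simp_all add: m_def field_simps)
  show "((\<lambda>i. Prob i (\<lambda>x. \<delta> \<le> \<bar>\<phi> x\<bar> \<and> (b - a) / 2 \<le> \<bar>x - m\<bar>)) \<longlongrightarrow> 0) F"
    using \<delta>_pos assms by (intro mass_outside_tendsto) (auto simp: m_def)
  show "\<forall>\<^sub>F i in F. Prob i (\<lambda>x. K < \<bar>x\<bar>) \<le> Prob i (\<lambda>x. \<delta> \<le> \<bar>\<phi> x\<bar> \<and> (b - a) / 2 \<le> \<bar>x - m\<bar>)"
  proof (intro always_eventually allI Prob_mono conjI)
    fix x assume x: "K < \<bar>x\<bar>"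
    then show "\<delta> \<le> \<bar>\<phi> x\<bar>" by (rule \<phi>_far)
    show "(b - a) / 2 \<le> \<bar>x - m\<bar>"
      using x order m by linarith
  qed
qed auto

text \<open>
  Any limit of the scaled stationary laws has a bounded density on the interval and, in particular, no
  atoms at the end points. The constant must not depend on \<open>e\<close>, because \<open>e\<close> is chosen small
  afterwards.
\<close>
lemma mass_near_point_le:
  assumes "a < b"
  obtains D where "0 < D"
    "\<And>y e. y \<in> {a..b} \<Longrightarrow> 0 < e \<Longrightarrow> \<forall>\<^sub>F i in F. Prob i (\<lambda>x. \<bar>x - y\<bar> \<le> e) \<le> D * e"
proof -
  define B where "B = \<bar>d\<bar> * (2 * K * (4 / (b - a)) + 2) + 4 / (b - a) * C / 2"
  define D where "D = 4 * (\<bar>B\<bar> + 1) / v + 1"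
  show thesis
  proof (rule that[of D])
    show "0 < D"
      using order unfolding D_def by (intro add_nonneg_pos) auto
    fix y e :: real assume y: "y \<in> {a..b}" and "0 < e"
    have "((\<lambda>i. C / e\<^sup>2 / t i) \<longlongrightarrow> 0) F"
      by (rule tendsto_divide_0[OF tendsto_const]) (rule filterlim_at_top_imp_at_infinity[OF t_top])
    then have "\<forall>\<^sub>F i in F. C / e\<^sup>2 / t i < 1"
      by (rule order_tendstoD(2)) simp
    moreover have "\<forall>\<^sub>F i in F. Prob i (\<lambda>x. K < \<bar>x\<bar>) < e"
      by (rule order_tendstoD(2)[OF mass_beyond_K_tendsto[OF assms] \<open>0 < e\<close>])
    ultimately show "\<forall>\<^sub>F i in F. Prob i (\<lambda>x. \<bar>x - y\<bar> \<le> e) \<le> D * e"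
      using eventually_confined
    proof eventually_elim
      case (elim i)
      have "v / (4 * e) * Prob i (\<lambda>x. \<bar>x - y\<bar> \<le> e \<and> \<bar>x\<bar> \<le> K) \<le> B + C / (e\<^sup>2 * t i)"
        using confined_walk.mass_near_point[OF elim(3) \<open>a < b\<close> y \<open>0 < e\<close>] by (simp add: B_def)
      also have "\<dots> \<le> \<bar>B\<bar> + 1"
        using elim(1) by simp
      finally have "Prob i (\<lambda>x. \<bar>x - y\<bar> \<le> e \<and> \<bar>x\<bar> \<le> K) \<le> 4 * (\<bar>B\<bar> + 1) / v * e"
        using order \<open>0 < e\<close> by (simp add: field_simps)
      moreover have "Prob i (\<lambda>x. \<bar>x - y\<bar> \<le> e)
          \<le> Prob i (\<lambda>x. (\<bar>x - y\<bar> \<le> e \<and> \<bar>x\<bar> \<le> K) \<or> K < \<bar>x\<bar>)"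
        by (rule Prob_mono) auto
      moreover have "Prob i (\<lambda>x. (\<bar>x - y\<bar> \<le> e \<and> \<bar>x\<bar> \<le> K) \<or> K < \<bar>x\<bar>)
          \<le> Prob i (\<lambda>x. \<bar>x - y\<bar> \<le> e \<and> \<bar>x\<bar> \<le> K) + Prob i (\<lambda>x. K < \<bar>x\<bar>)"
        by (rule Prob_disj)
      ultimately show ?case
        using elim(2) unfolding D_def distrib_right by linarith
    qed
  qed
qed

text \<open>
  A point outside \<open>(a, b)\<close> is either far from the interval or close to an end point.
\<close>
lemma mass_outside_interval_tendsto:
  assumes "a < b"
  shows "((\<lambda>i. Prob i (\<lambda>x. x \<notin> {a<..<b})) \<longlongrightarrow> 0) F"
proof (rule order_tendstoI)
  fix \<rho> :: real assume "0 < \<rho>"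
  obtain D where "0 < D" and D: "\<And>y e. y \<in> {a..b} \<Longrightarrow> 0 < e \<Longrightarrow> \<forall>\<^sub>F i in F. Prob i (\<lambda>x. \<bar>x - y\<bar> \<le> e) \<le> D * e"
    by (rule mass_near_point_le[OF assms]) (rule that)
  define e where "e = \<rho> / (4 * D)"
  have "0 < e" "D * e = \<rho> / 4"
    using \<open>0 < D\<close> \<open>0 < \<rho>\<close> by (simp_all add: e_def)
  have "\<forall>\<^sub>F i in F. Prob i (\<lambda>x. x \<le> a - e \<or> b + e \<le> x) < \<rho> / 4"
    by (rule order_tendstoD(2)[OF mass_far_tendsto[OF \<open>0 < e\<close>]]) (use \<open>0 < \<rho>\<close> in simp)
  moreover have "\<forall>\<^sub>F i in F. Prob i (\<lambda>x. \<bar>x - a\<bar> \<le> e) \<le> D * e" "\<forall>\<^sub>F i in F. Prob i (\<lambda>x. \<bar>x - b\<bar> \<le> e) \<le> D * e"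
    using assms \<open>0 < e\<close> by (auto intro: D)
  ultimately show "\<forall>\<^sub>F i in F. Prob i (\<lambda>x. x \<notin> {a<..<b}) < \<rho>"
  proof eventually_elim
    case (elim i)
    have "Prob i (\<lambda>x. x \<notin> {a<..<b})
        \<le> Prob i (\<lambda>x. (x \<le> a - e \<or> b + e \<le> x) \<or> (\<bar>x - a\<bar> \<le> e \<or> \<bar>x - b\<bar> \<le> e))"
      by (rule Prob_mono) auto
    also have "\<dots> \<le> Prob i (\<lambda>x. x \<le> a - e \<or> b + e \<le> x) + Prob i (\<lambda>x. \<bar>x - a\<bar> \<le> e \<or> \<bar>x - b\<bar> \<le> e)"
      by (rule Prob_disj)
    also have "\<dots> \<le> Prob i (\<lambda>x. x \<le> a - e \<or> b + e \<le> x) + (Prob i (\<lambda>x. \<bar>x - a\<bar> \<le> e) + Prob i (\<lambda>x. \<bar>x - b\<bar> \<le> e))"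
      by (intro add_left_mono Prob_disj)
    also have "\<dots> < \<rho>"
      using elim \<open>D * e = \<rho> / 4\<close> \<open>0 < \<rho>\<close> by linarith
    finally show ?case .
  qed
qed (rule always_eventually, use measure_nonneg less_le_trans in blast)

lemma cdf_below_tendsto:
  assumes "a < b" "x0 \<le> a"
  shows "((\<lambda>i. Prob i (\<lambda>x. x \<le> x0)) \<longlongrightarrow> 0) F"
proof (rule tendsto_sandwich[OF _ _ tendsto_const mass_outside_interval_tendsto[OF assms(1)]])
  show "\<forall>\<^sub>F i in F. Prob i (\<lambda>x. x \<le> x0) \<le> Prob i (\<lambda>x. x \<notin> {a<..<b})"
    using assms by (intro always_eventually allI Prob_mono) auto
qed auto

lemma Prob_compl: "Prob i (\<lambda>x. \<not> P x) = 1 - Prob i P"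
  using measure_pmf.prob_compl[of "{z. P (real_of_int z / t i)}" "p i"]
  by (simp add: Compl_eq_Diff_UNIV[symmetric] Collect_neg_eq)

lemma cdf_above_tendsto:
  assumes "a < b" "b \<le> x0"
  shows "((\<lambda>i. Prob i (\<lambda>x. x \<le> x0)) \<longlongrightarrow> 1) F"
proof -
  have "((\<lambda>i. Prob i (\<lambda>x. \<not> x \<le> x0)) \<longlongrightarrow> 0) F"
  proof (rule tendsto_sandwich[OF _ _ tendsto_const mass_outside_interval_tendsto[OF assms(1)]])
    show "\<forall>\<^sub>F i in F. Prob i (\<lambda>x. \<not> x \<le> x0) \<le> Prob i (\<lambda>x. x \<notin> {a<..<b})"
      using assms by (intro always_eventually allI Prob_mono) auto
  qed auto
  from tendsto_diff[OF tendsto_const[of 1] this] show ?thesis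
    by (simp only: Prob_compl[of _ "\<lambda>x. x \<le> x0"]) simp
qed

text \<open>
  The Stein estimate, with \<open>e\<close> chosen first so that the mass near the kinks contributes little. The
  remaining error terms vanish in the limit for this fixed \<open>e\<close>.
\<close>
lemma cdf_inside_tendsto:
  fixes W :: "real \<Rightarrow> real"
  assumes x0: "a < x0" "x0 < b"
    and W: "\<And>x. (W has_real_derivative exp (- (2 * d / s) * x)) (at x)" "W a = 0"
      "0 \<le> W x0" "W x0 \<le> W b" "0 < W b"
  shows "((\<lambda>i. Prob i (\<lambda>x. x \<le> x0)) \<longlongrightarrow> W x0 / W b) F"
proof (rule tendstoI)
  fix \<rho> :: real assume "0 < \<rho>"
  define R where "R = W x0 / W b"
  have R: "0 \<le> R" "R \<le> 1"
    using W by (simp_all add: R_def)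
  have ab: "a < b" using x0 by simp
  obtain f g q L where L: "0 < L" "\<And>x. \<bar>f x\<bar> \<le> L" "\<And>x. \<bar>g x\<bar> \<le> L" "\<And>x. \<bar>q x\<bar> \<le> L"
    and f2: "\<And>x u. \<bar>f (x + u) - f x - g x * u\<bar> \<le> L * u\<^sup>2"
    and out: "\<And>x. x \<notin> {a<..<b} \<Longrightarrow> g x = 0" "\<And>x. x \<notin> {a<..<b} \<Longrightarrow> q x = 0"
    and ode: "\<And>x. x \<in> {a<..<b} \<Longrightarrow> q x = 2 / s * ((if x \<le> x0 then 1 else 0) - W x0 / W b) + 2 * d / s * g x"
    and f3: "\<And>e x u. e > 0 \<Longrightarrow> (\<And>y. y \<in> {a, x0, b} \<Longrightarrow> e < \<bar>x - y\<bar>) \<Longrightarrow>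
       \<bar>f (x + u) - f x - g x * u - q x * u\<^sup>2 / 2\<bar> \<le> (L + 2 * L / e) * \<bar>u\<bar> ^ 3"
    apply (rule stein_test_exists[OF x0 s_pos W(1,2,5)])
    subgoal premises prems for f g q L by (rule that[of L f g q]; fact prems)
    done
  obtain D where "0 < D" and D: "\<And>y e. y \<in> {a..b} \<Longrightarrow> 0 < e \<Longrightarrow> \<forall>\<^sub>F i in F. Prob i (\<lambda>x. \<bar>x - y\<bar> \<le> e) \<le> D * e"
    by (rule mass_near_point_le[OF ab]) (rule that)
  define B where "B = \<bar>L * C + L * \<bar>d\<bar> + 1\<bar> + 1"
  have "0 < B" by (simp add: B_def)
  define e where "e = \<rho> / (12 * D * B)"
  have "0 < e"
    using \<open>0 < D\<close> \<open>0 < B\<close> \<open>0 < \<rho>\<close> by (simp add: e_def)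
  have e: "B * (3 * (D * e)) = \<rho> / 4"
    using \<open>0 < D\<close> \<open>0 < B\<close> by (simp add: e_def field_simps)
  define Q where "Q = L + 2 * L / e"
  have "0 \<le> Q" using L(1) \<open>0 < e\<close> by (simp add: Q_def)
  have "((\<lambda>i. Q * C / t i) \<longlongrightarrow> 0) F"
    by (rule tendsto_divide_0[OF tendsto_const]) (rule filterlim_at_top_imp_at_infinity[OF t_top])
  then have "\<forall>\<^sub>F i in F. Q * C / t i < \<rho> / 4"
    by (rule order_tendstoD(2)) (use \<open>0 < \<rho>\<close> in simp)
  moreover have "((\<lambda>i. L * \<kappa> i / 2) \<longlongrightarrow> L * 0 / 2) F"
    by (intro tendsto_intros \<kappa>_zero) simp
  then have "\<forall>\<^sub>F i in F. L * \<kappa> i / 2 < \<rho> / 8"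
    by (rule order_tendstoD(2)) (use \<open>0 < \<rho>\<close> in simp)
  moreover have "\<forall>\<^sub>F i in F. Prob i (\<lambda>x. x \<notin> {a<..<b}) < \<rho> / 8"
    by (rule order_tendstoD(2)[OF mass_outside_interval_tendsto[OF ab]]) (use \<open>0 < \<rho>\<close> in simp)
  moreover have "\<forall>\<^sub>F i in F. Prob i (\<lambda>x. \<bar>x - a\<bar> \<le> e) \<le> D * e" "\<forall>\<^sub>F i in F. Prob i (\<lambda>x. \<bar>x - x0\<bar> \<le> e) \<le> D * e"
     "\<forall>\<^sub>F i in F. Prob i (\<lambda>x. \<bar>x - b\<bar> \<le> e) \<le> D * e"
    using x0 \<open>0 < e\<close> by (auto intro: D)
  ultimately show "\<forall>\<^sub>F i in F. dist (Prob i (\<lambda>x. x \<le> x0)) (W x0 / W b) < \<rho>"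
    using eventually_confined variance
  proof eventually_elim
    case (elim i)
    define Hi where "Hi = Prob i (\<lambda>x. x \<in> {a<..<b} \<and> x \<le> x0)"
    define Ii where "Ii = Prob i (\<lambda>x. x \<in> {a<..<b})"
    define Zi where "Zi = Prob i (\<lambda>x. \<exists>y\<in>{a, x0, b}. \<bar>x - y\<bar> \<le> e)"
    have "\<bar>Hi - R * Ii\<bar> \<le> Q * C / t i + L * max 0 (\<kappa> i) / 2 + (L * C + L * \<bar>d\<bar> + 1) * Zi"
      unfolding Hi_def Ii_def Zi_def
    proof (rule confined_walk.stein_estimate[OF elim(7), where f = f and g = g and q = q])
      show "\<And>x u. (\<And>y. y \<in> {a, x0, b} \<Longrightarrow> e < \<bar>x - y\<bar>) \<Longrightarrow>
         \<bar>f (x + u) - f x - g x * u - q x * u\<^sup>2 / 2\<bar> \<le> Q * \<bar>u\<bar> ^ 3"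
        unfolding Q_def by (rule f3[OF \<open>0 < e\<close>])
      show "\<And>z. real_of_int z / t i \<in> {a<..<b} \<Longrightarrow>
          \<bar>stationary_walk.second_moment (J i) z - s\<bar> \<le> max 0 (\<kappa> i)"
        using elim(8) by (meson max.coboundedI2)
      show "\<And>x. x \<in> {a<..<b} \<Longrightarrow> q x = 2 / s * ((if x \<le> x0 then 1 else 0) - R) + 2 * d / s * g x"
        unfolding R_def by (rule ode)
    qed (use x0 ab s_pos R \<open>0 < e\<close> L f2 out \<open>0 \<le> Q\<close> in auto)
    moreover have "(L * C + L * \<bar>d\<bar> + 1) * Zi \<le> \<rho> / 4"
    proof -
      have "Zi \<le> Prob i (\<lambda>x. \<bar>x - a\<bar> \<le> e \<or> (\<bar>x - x0\<bar> \<le> e \<or> \<bar>x - b\<bar> \<le> e))"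
        unfolding Zi_def by (rule Prob_mono) auto
      also have "\<dots> \<le> Prob i (\<lambda>x. \<bar>x - a\<bar> \<le> e) + Prob i (\<lambda>x. \<bar>x - x0\<bar> \<le> e \<or> \<bar>x - b\<bar> \<le> e)"
        by (rule Prob_disj)
      also have "\<dots> \<le> Prob i (\<lambda>x. \<bar>x - a\<bar> \<le> e) + (Prob i (\<lambda>x. \<bar>x - x0\<bar> \<le> e) + Prob i (\<lambda>x. \<bar>x - b\<bar> \<le> e))"
        by (intro add_left_mono Prob_disj)
      also have "\<dots> \<le> 3 * (D * e)"
        using elim(4-6) by linarith
      finally have "B * Zi \<le> B * (3 * (D * e))"
        using \<open>0 < B\<close> by (intro mult_left_mono) auto
      moreover have "(L * C + L * \<bar>d\<bar> + 1) * Zi \<le> B * Zi"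
        by (intro mult_right_mono) (auto simp: B_def Zi_def)
      ultimately show ?thesis using e by simp
    qed
    moreover have "L * max 0 (\<kappa> i) / 2 < \<rho> / 8"
      using elim(2) \<open>0 < \<rho>\<close> by (simp add: max_def)
    ultimately have main: "\<bar>Hi - R * Ii\<bar> < \<rho> / 4 + \<rho> / 8 + \<rho> / 4"
      using elim(1) by linarith
    have Ii: "0 \<le> 1 - Ii" "1 - Ii < \<rho> / 8"
      using elim(3) Prob_compl[of i "\<lambda>x. x \<in> {a<..<b}"]
        measure_pmf.prob_le_1[of "p i" "{z. real_of_int z / t i \<in> {a<..<b}}"]
      unfolding Ii_def by linarith+
    have "R * (1 - Ii) \<le> 1 * (1 - Ii)" "0 \<le> R * (1 - Ii)"
      using R Ii by (intro mult_right_mono mult_nonneg_nonneg; simp)+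
    then have RI: "\<bar>R * Ii - R\<bar> < \<rho> / 8"
      using Ii by (simp add: algebra_simps abs_le_iff abs_less_iff)
    have "Hi \<le> Prob i (\<lambda>x. x \<le> x0)"
      unfolding Hi_def by (rule Prob_mono) auto
    moreover have "Prob i (\<lambda>x. x \<le> x0) \<le> Prob i (\<lambda>x. (x \<in> {a<..<b} \<and> x \<le> x0) \<or> x \<notin> {a<..<b})"
      by (rule Prob_mono) auto
    moreover have "\<dots> \<le> Hi + Prob i (\<lambda>x. x \<notin> {a<..<b})"
      unfolding Hi_def by (rule Prob_disj)
    ultimately have "\<bar>Prob i (\<lambda>x. x \<le> x0) - Hi\<bar> < \<rho> / 8"
      using elim(3) by linarith
    with main RI have "\<bar>Prob i (\<lambda>x. x \<le> x0) - R\<bar> < \<rho>"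
      by linarith
    then show ?case
      by (simp add: dist_real_def R_def)
  qed
qed

end


section \<open>Truncated exponential laws and the unit mass\<close>

text \<open>
  The integral of \<open>exp (- l * t)\<close> over \<open>t\<close> from \<open>a\<close> to \<open>x\<close>.
\<close>
definition exp_primitive :: "real \<Rightarrow> real \<Rightarrow> real \<Rightarrow> real" where
  "exp_primitive l a x = (if l = 0 then x - a else (exp (- l * a) - exp (- l * x)) / l)"

lemma exp_primitive_derivative:
  "(exp_primitive l a has_real_derivative exp (- l * x)) (at x)"
proof (cases "l = 0")
  case True
  then show ?thesis
    unfolding exp_primitive_def by (auto intro!: derivative_eq_intros)
next
  case False
  then show ?thesis
    unfolding exp_primitive_def by (auto intro!: derivative_eq_intros)
qed

lemma exp_primitive_start [simp]: "exp_primitive l a a = 0"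
  by (simp add: exp_primitive_def)

lemma exp_primitive_less: "x < y \<Longrightarrow> exp_primitive l a x < exp_primitive l a y"
  by (rule DERIV_pos_imp_increasing)
     (use exp_primitive_derivative in \<open>auto intro!: exI\<close>)

lemma exp_primitive_le: "x \<le> y \<Longrightarrow> exp_primitive l a x \<le> exp_primitive l a y"
  using exp_primitive_less[of x y l a] by (cases "x = y") auto

lemma nn_integral_exp_interval:
  assumes A: "{a<..<b} \<subseteq> A" "A \<subseteq> {a..b}" and "a \<le> x" "x \<le> b"
  shows "(\<integral>\<^sup>+ t. ennreal (exp (- l * t)) * indicator A t * indicator {..x} t \<partial>lborel)
       = ennreal (exp_primitive l a x)"
proof -
  have "(\<integral>\<^sup>+ t. ennreal (exp (- l * t)) * indicator A t * indicator {..x} t \<partial>lborel)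
      = (\<integral>\<^sup>+ t. ennreal (exp (- l * t)) * indicator {a..x} t \<partial>lborel)"
  proof (rule nn_integral_cong_AE)
    show "AE t in lborel. ennreal (exp (- l * t)) * indicator A t * indicator {..x} t
        = ennreal (exp (- l * t)) * indicator {a..x} t"
      using AE_lborel_singleton[of a] AE_lborel_singleton[of b]
    proof eventually_elim
      case (elim t)
      have "t \<in> A \<longleftrightarrow> t \<in> {a..b}" using A elim by force
      then show ?case using assms by (auto simp: indicator_def)
    qed
  qed
  also have "\<dots> = ennreal (exp_primitive l a x - exp_primitive l a a)"
    using \<open>a \<le> x\<close> by (intro nn_integral_FTC_Icc) (auto intro: has_field_derivative_at_within exp_primitive_derivative[simplified])
  finally show ?thesis by simp
qed

text \<open>
  An interval determines the law whether or not its end points belong to it, since these are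
  Lebesgue null sets.
\<close>
lemma trunc_exp_interval:
  assumes A: "{a<..<b} \<subseteq> A" "A \<subseteq> {a..b}" and "a < b" and [measurable]: "A \<in> sets borel"
  shows "real_distribution (trunc_exp l A)"
    and "x \<le> a \<Longrightarrow> cdf (trunc_exp l A) x = 0"
    and "a \<le> x \<Longrightarrow> x \<le> b \<Longrightarrow> cdf (trunc_exp l A) x = exp_primitive l a x / exp_primitive l a b"
    and "b \<le> x \<Longrightarrow> cdf (trunc_exp l A) x = 1"
proof -
  define W where "W = exp_primitive l a"
  have Wb: "0 < W b"
    using exp_primitive_less[OF \<open>a < b\<close>, of l a] by (simp add: W_def)
  have "(\<integral>\<^sup>+t\<in>A. ennreal (exp (- l * t)) \<partial>lborel)
      = (\<integral>\<^sup>+ t. ennreal (exp (- l * t)) * indicator A t * indicator {..b} t \<partial>lborel)"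
    using A by (intro nn_integral_cong) (auto simp: indicator_def)
  then have Z: "(\<integral>\<^sup>+t\<in>A. ennreal (exp (- l * t)) \<partial>lborel) = ennreal (W b)"
    using nn_integral_exp_interval[OF A, of b l] \<open>a < b\<close> by (simp add: W_def)
  have dens: "emeasure (trunc_exp l A) X
      = (\<integral>\<^sup>+ t. ennreal (exp (- l * t)) * indicator A t * indicator X t \<partial>lborel) / ennreal (W b)"
    if [measurable]: "X \<in> sets borel" for X
  proof -
    have "emeasure (trunc_exp l A) X
      = (\<integral>\<^sup>+ t. ennreal (exp (- l * t)) * indicator A t / ennreal (W b) * indicator X t \<partial>lborel)"
      unfolding trunc_exp_def Z by (rule emeasure_density) auto
    also have "\<dots> = (\<integral>\<^sup>+ t. ennreal (exp (- l * t)) * indicator A t * indicator X t / ennreal (W b) \<partial>lborel)"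
      by (intro nn_integral_cong) (simp add: divide_ennreal_def mult_ac)
    also have "\<dots> = (\<integral>\<^sup>+ t. ennreal (exp (- l * t)) * indicator A t * indicator X t \<partial>lborel) / ennreal (W b)"
      by (rule nn_integral_divide) auto
    finally show ?thesis .
  qed
  have inside: "emeasure (trunc_exp l A) {..x} = ennreal (W x / W b)" if "a \<le> x" "x \<le> b" for x
    using nn_integral_exp_interval[OF A that, of l] Wb that exp_primitive_le[OF that(1), of l a]
    by (simp add: dens W_def divide_ennreal)
  have "emeasure (trunc_exp l A) UNIV
      = (\<integral>\<^sup>+ t. ennreal (exp (- l * t)) * indicator A t \<partial>lborel) / ennreal (W b)"
    by (simp add: dens)
  then have "emeasure (trunc_exp l A) UNIV = 1"
    using Z Wb by (simp add: ennreal_divide_self)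
  moreover have sp: "space (trunc_exp l A) = UNIV" "sets (trunc_exp l A) = sets borel"
    by (simp_all add: trunc_exp_def)
  ultimately have prob: "prob_space (trunc_exp l A)"
    by (intro prob_spaceI) simp
  then show dist: "real_distribution (trunc_exp l A)"
    using sp by (simp add: real_distribution_def real_distribution_axioms_def)
  interpret real_distribution "trunc_exp l A" by (rule dist)
  show mid: "cdf (trunc_exp l A) x = exp_primitive l a x / exp_primitive l a b" if "a \<le> x" "x \<le> b" for x
  proof -
    have "0 \<le> W x"
      using exp_primitive_le[OF that(1), of l a] by (simp add: W_def)
    then show ?thesis
      unfolding cdf_def measure_def inside[OF that] using Wb by (simp add: W_def)
  qed
  show "cdf (trunc_exp l A) x = 0" if "x \<le> a"
  proof -
    have "cdf (trunc_exp l A) x \<le> cdf (trunc_exp l A) a"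
      using that by (rule cdf_nondecreasing)
    then show ?thesis
      using mid[of a] \<open>a < b\<close> cdf_nonneg[of x] by simp
  qed
  show "cdf (trunc_exp l A) x = 1" if "b \<le> x"
  proof -
    have "cdf (trunc_exp l A) b \<le> cdf (trunc_exp l A) x"
      using that by (rule cdf_nondecreasing)
    then show ?thesis
      using mid[of b] \<open>a < b\<close> cdf_bounded_prob[of x] Wb by (simp add: W_def)
  qed
qed

lemma uniform_eq_trunc_exp:
  assumes "A \<in> sets borel"
  shows "uniform_measure lborel A = trunc_exp 0 A"
  using assms by (simp add: uniform_measure_def trunc_exp_def)

lemma cdf_return_zero: "cdf (return borel 0) x = (if 0 \<le> x then 1 else 0)" for x :: real
  by (auto simp: cdf_def measure_return indicator_def)

text \<open>
  The distribution function of the unit mass at \<open>0\<close> jumps there, so convergence in distribution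
  imposes nothing at \<open>0\<close> itself.
\<close>
lemma return_zero_continuity_point:
  assumes "isCont (cdf (return borel (0::real))) x"
  shows "x \<noteq> 0"
proof
  assume "x = 0"
  then have "cdf (return borel (0::real)) \<midarrow>0\<rightarrow> 1"
    using assms by (simp add: isCont_def cdf_return_zero)
  then have "(cdf (return borel (0::real)) \<longlongrightarrow> 1) (at_left 0)"
    by (rule filterlim_mono[OF _ order_refl at_le]) simp
  moreover have "\<forall>\<^sub>F y in at_left (0::real). cdf (return borel 0) y = 0"
    unfolding eventually_at_left_field by (auto simp: cdf_return_zero intro: exI[of _ "- 1"])
  then have "(cdf (return borel (0::real)) \<longlongrightarrow> 0) (at_left 0)"
    by (rule tendsto_eventually)
  ultimately show False
    using tendsto_unique[of "at_left (0::real)"] by fastforce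
qed


section \<open>Drift of the controlled queue\<close>

lemma clip_add_le:
  assumes "lo + k \<le> m" "m \<le> hi" "s \<le> 0" "0 \<le> k"
  shows "clip (m + s) hi lo \<le> m - min (- s) k"
  using assms by (auto simp: clip_def max_def min_def)

lemma clip_add_ge:
  assumes "lo \<le> m" "m + k \<le> hi" "0 \<le> s" "0 \<le> k"
  shows "m + min s k \<le> clip (m + s) hi lo"
  using assms by (auto simp: clip_def max_def min_def)

lemma clip_same: "lo \<le> m \<Longrightarrow> m \<le> hi \<Longrightarrow> clip m hi lo = m"
  by (simp add: clip_def)

text \<open>
  At least one of \<open>u\<close> and \<open>w\<close> reaches \<open>r\<close>: of the two control curves at least one carries half of the net
  drift, and clipping leaves it an effect of at least \<open>k\<close>.
\<close>
lemma min_add_min_ge: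
  fixes u w k :: real
  assumes "0 \<le> u" "0 \<le> w" "0 \<le> k" "2 * r \<le> u + w"
  shows "min r k \<le> min u k + min w k"
  using assms by (auto simp: min_def)

text \<open>
  Inside \<open>(a, b)\<close> both control curves vanish, so the arrival rates are \<open>m\<close> and \<open>\<mu>\<close>, and the drift
  of the scaled walk is \<open>t * (m - \<mu>) = - d\<close>. To the right, monotonicity lowers the customer rate and raises the
  server rate, and to the left conversely; clipping preserves these signs. The distance \<open>k\<close> of the
  nominal rates from their bounds leaves room for a change of at least \<open>min (eps * c / 2) k\<close> where the
  net drift curve is at least \<open>c\<close> in absolute value.
\<close>
lemma matching_queue_confined:
  fixes N :: "'w measure" and ac as :: "int \<Rightarrow> nat \<Rightarrow> 'w \<Rightarrow> nat"
    and \<phi>c \<phi>s :: "real \<Rightarrow> real" and t eps m \<mu> k d :: real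
  assumes queue: "matching_queue N ac as (controlled_rate m eps t \<phi>c lam_max lam_min)
        (controlled_rate \<mu> eps t \<phi>s mu_max mu_min) \<sigma>c \<sigma>s M"
    and D: "stationary_distribution N (imbalance ac as) D"
    and pos: "0 < t" "0 < eps" and m: "m = \<mu> - d / t"
    and gap: "0 < k" "lam_min + k \<le> m" "m + k \<le> lam_max" "mu_min + k \<le> \<mu>" "\<mu> + k \<le> mu_max"
    and mono: "antimono \<phi>c" "mono \<phi>s"
    and zero: "\<And>x. a < x \<Longrightarrow> x < b \<Longrightarrow> \<phi>c x = 0 \<and> \<phi>s x = 0" "\<phi>c 0 = 0" "\<phi>s 0 = 0"
    and order: "- K \<le> a" "a \<le> 0" "0 \<le> b" "b \<le> K"
    and far: "\<And>x. K < \<bar>x\<bar> \<Longrightarrow> c \<le> \<bar>\<phi>c x - \<phi>s x\<bar>" and "0 < c"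
    and strong: "2 * \<bar>d\<bar> \<le> t * min (eps * c / 2) k"
    and jumps: "0 < \<pi>" "\<And>z. \<bar>of_int z\<bar> \<le> K * t \<Longrightarrow> measure N {w \<in> space N. ac z 0 w > as z 0 w} \<ge> \<pi>"
      "\<And>z. \<bar>of_int z\<bar> \<le> K * t \<Longrightarrow> measure N {w \<in> space N. ac z 0 w < as z 0 w} \<ge> \<pi>"
  shows "confined_walk (Abs_pmf D) (matching_queue.jump_pmf N ac as) (2 * M) a b K t d
           (t * min (eps * c / 2) k) (2 * \<pi>) {x. c \<le> \<bar>\<phi>c x - \<phi>s x\<bar>}"
    and "real_of_int z / t \<in> {a<..<b} \<or> z = 0 \<Longrightarrow>
      stationary_walk.second_moment (matching_queue.jump_pmf N ac as) z = \<sigma>c m + \<sigma>s \<mu> + (d / t)\<^sup>2"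
proof -
  interpret matching_queue N ac as "controlled_rate m eps t \<phi>c lam_max lam_min"
    "controlled_rate \<mu> eps t \<phi>s mu_max mu_min" \<sigma>c \<sigma>s M
    by (rule queue)
  interpret stationary_walk "Abs_pmf D" jump_pmf "2 * M"
    by (rule stationary_walk[OF D])
  let ?lam = "controlled_rate m eps t \<phi>c lam_max lam_min" and ?mu = "controlled_rate \<mu> eps t \<phi>s mu_max mu_min"
  let ?T = "t * min (eps * c / 2) k" and ?Out = "{x. c \<le> \<bar>\<phi>c x - \<phi>s x\<bar>}"
  have drift: "drift z = ?lam z - ?mu z" for z
    by (simp add: drift_def expectation_jump_pmf expectation_jump)
  have second: "second_moment z = \<sigma>c (?lam z) + \<sigma>s (?mu z) + (?lam z - ?mu z)\<^sup>2" for z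
    by (simp add: second_moment_def expectation_jump_pmf expectation_jump_square)
  have rates: "?lam z = m" "?mu z = \<mu>" if "real_of_int z / t \<in> {a<..<b} \<or> z = 0" for z
    using that zero(1)[of "real_of_int z / t"] zero(2,3) gap by (auto simp: controlled_rate_def clip_same)
  show "second_moment z = \<sigma>c m + \<sigma>s \<mu> + (d / t)\<^sup>2" if "real_of_int z / t \<in> {a<..<b} \<or> z = 0"
    using rates[OF that] by (simp add: second m)
  have push: "?T * indicator ?Out x \<le> t * (min u k + min w k)"
    if "0 \<le> u" "0 \<le> w" "u + w = eps * \<bar>\<phi>c x - \<phi>s x\<bar>" for u w x
  proof (cases "x \<in> ?Out")
    case True
    then have "2 * (eps * c / 2) \<le> u + w"
      using that(3) pos by simp
    then show ?thesis
      using min_add_min_ge[OF that(1,2), of k "eps * c / 2"] gap(1) pos True by simp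
  next
    case False
    then show ?thesis using that gap(1) pos by simp
  qed
  show "confined_walk (Abs_pmf D) jump_pmf (2 * M) a b K t d ?T (2 * \<pi>) ?Out"
  proof
    fix z
    define x where "x = real_of_int z / t"
    show "t * drift z = - d" if "real_of_int z / t \<in> {a<..<b}"
      using rates[of z] that pos by (simp add: drift m)
    show "t * drift z \<le> - d - ?T * indicator ?Out (real_of_int z / t)" if "b \<le> real_of_int z / t"
    proof -
      have "0 \<le> x" using that order unfolding x_def by linarith
      then have sg: "\<phi>c x \<le> 0" "0 \<le> \<phi>s x"
        using antimonoD[OF mono(1), of 0 x] monoD[OF mono(2), of 0 x] zero by auto
      then have s: "eps * \<phi>c x \<le> 0" "0 \<le> eps * \<phi>s x"
        using pos by (simp_all add: mult_nonneg_nonpos)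
      have "?lam z \<le> m - min (- (eps * \<phi>c x)) k"
        unfolding controlled_rate_def x_def[symmetric] using gap s by (intro clip_add_le) auto
      moreover have "\<mu> + min (eps * \<phi>s x) k \<le> ?mu z"
        unfolding controlled_rate_def x_def[symmetric] using gap s by (intro clip_add_ge) auto
      ultimately have "drift z \<le> - d / t - (min (- (eps * \<phi>c x)) k + min (eps * \<phi>s x) k)"
        unfolding drift m by linarith
      then have "t * drift z \<le> t * (- d / t - (min (- (eps * \<phi>c x)) k + min (eps * \<phi>s x) k))"
        using pos by (intro mult_left_mono) auto
      also have "\<dots> = - d - t * (min (- (eps * \<phi>c x)) k + min (eps * \<phi>s x) k)"
        using pos by (simp add: right_diff_distrib)
      also have "\<dots> \<le> - d - ?T * indicator ?Out x"
      proof -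
        have "- (eps * \<phi>c x) + eps * \<phi>s x = eps * \<bar>\<phi>c x - \<phi>s x\<bar>"
          using sg by (simp add: algebra_simps)
        from push[OF _ s(2) this] s(1) show ?thesis by simp
      qed
      finally show ?thesis unfolding x_def .
    qed
    show "- d + ?T * indicator ?Out (real_of_int z / t) \<le> t * drift z" if "real_of_int z / t \<le> a"
    proof -
      have "x \<le> 0" using that order unfolding x_def by linarith
      then have sg: "0 \<le> \<phi>c x" "\<phi>s x \<le> 0"
        using antimonoD[OF mono(1), of x 0] monoD[OF mono(2), of x 0] zero by auto
      then have s: "0 \<le> eps * \<phi>c x" "eps * \<phi>s x \<le> 0"
        using pos by (simp_all add: mult_nonneg_nonpos)
      have "m + min (eps * \<phi>c x) k \<le> ?lam z"
        unfolding controlled_rate_def x_def[symmetric] using gap s by (intro clip_add_ge) auto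
      moreover have "?mu z \<le> \<mu> - min (- (eps * \<phi>s x)) k"
        unfolding controlled_rate_def x_def[symmetric] using gap s by (intro clip_add_le) auto
      ultimately have dr: "- d / t + (min (eps * \<phi>c x) k + min (- (eps * \<phi>s x)) k) \<le> drift z"
        unfolding drift m by linarith
      have "- d + ?T * indicator ?Out x \<le> - d + t * (min (eps * \<phi>c x) k + min (- (eps * \<phi>s x)) k)"
      proof -
        have "eps * \<phi>c x + - (eps * \<phi>s x) = eps * \<bar>\<phi>c x - \<phi>s x\<bar>"
          using sg by (simp add: algebra_simps)
        from push[OF s(1) _ this] s(2) show ?thesis by simp
      qed
      also have "\<dots> = t * (- d / t + (min (eps * \<phi>c x) k + min (- (eps * \<phi>s x)) k))"
        using pos by (simp add: distrib_left right_diff_distrib)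
      also have "\<dots> \<le> t * drift z"
        using dr pos by (intro mult_left_mono) auto
      finally show ?thesis unfolding x_def .
    qed
    show "2 * \<pi> \<le> second_moment z" if "\<bar>real_of_int z / t\<bar> \<le> K"
    proof -
      have "\<bar>real_of_int z\<bar> \<le> K * t"
        using that pos by (simp add: field_simps)
      then show ?thesis
        using jump_square_ge[OF jumps(2,3)] by (simp add: second_moment_def expectation_jump_pmf)
    qed
  next
    show "?Out \<inter> {a<..<b} = {}"
      using zero(1) \<open>0 < c\<close> by auto
    show "\<bar>x\<bar> \<le> K" if "x \<notin> ?Out" for x
      using far[of x] that by force
  qed (use pos order strong jumps(1) in auto)
qed

text \<open>
  The zero set of a monotone function is an interval, which may or may not contain its end points.
\<close>
lemma interval_of_zeros:
  fixes \<phi> :: "real \<Rightarrow> real"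
  assumes "antimono \<phi>" "Z = {x. \<phi> x = 0}" "0 \<in> Z" "Z \<subseteq> {- K..K}"
  shows "{Inf Z<..<Sup Z} \<subseteq> Z" "Z \<subseteq> {Inf Z..Sup Z}" "Inf Z \<le> 0" "0 \<le> Sup Z"
    "- K \<le> Inf Z" "Sup Z \<le> K" "\<And>x. Sup Z < x \<Longrightarrow> \<phi> x < 0" "\<And>x. x < Inf Z \<Longrightarrow> 0 < \<phi> x"
proof -
  have bdd: "bdd_below Z" "bdd_above Z" and ne: "Z \<noteq> {}"
    using assms(3,4) by (auto intro: bdd_below_mono bdd_above_mono)
  have lower: "Inf Z \<le> x" and upper: "x \<le> Sup Z" if "x \<in> Z" for x
    using that bdd by (auto intro: cInf_lower cSup_upper)
  then show sub: "Z \<subseteq> {Inf Z..Sup Z}" and "Inf Z \<le> 0" "0 \<le> Sup Z"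
    using assms(3) by auto
  show "- K \<le> Inf Z" "Sup Z \<le> K"
    using assms(4) by (force intro!: cInf_greatest[OF ne] cSup_least[OF ne])+
  show "{Inf Z<..<Sup Z} \<subseteq> Z"
  proof
    fix x assume x: "x \<in> {Inf Z<..<Sup Z}"
    obtain y where "y \<in> Z" "y < x"
      using x cInf_lessD[OF ne, of x] by auto
    moreover obtain y' where "y' \<in> Z" "x < y'"
      using x less_cSupE[of x Z] ne by auto
    ultimately have "\<phi> x \<le> 0" "0 \<le> \<phi> x"
      using antimonoD[OF assms(1), of y x] antimonoD[OF assms(1), of x y'] assms(2) by auto
    then show "x \<in> Z" using assms(2) by simp
  qed
  have z0: "\<phi> 0 = 0" using assms(2,3) by simp
  show "\<phi> x < 0" if "Sup Z < x" for x
  proof -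
    have "x \<notin> Z" "0 \<le> x" using upper[of x] that upper[OF assms(3)] by auto
    then show ?thesis
      using antimonoD[OF assms(1), of 0 x] z0 assms(2) by auto
  qed
  show "0 < \<phi> x" if "x < Inf Z" for x
  proof -
    have "x \<notin> Z" "x \<le> 0" using lower[of x] that lower[OF assms(3)] by auto
    then show ?thesis
      using antimonoD[OF assms(1), of x 0] z0 assms(2) by auto
  qed
qed


section \<open>The scaled imbalance in the limit\<close>

theorem theorem3:
  fixes lam_max lam_min mu_max mu_min \<sigma>_max M mu_star d \<delta> K B \<beta> p_min \<eta>0 \<eta>p \<sigma>_star :: real
    and \<sigma>c \<sigma>s \<phi>c \<phi>s :: "real \<Rightarrow> real"
    and \<epsilon> \<tau> lam_star :: "real \<Rightarrow> real"
    and N :: "real \<Rightarrow> 'w measure"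
    and ac as :: "real \<Rightarrow> int \<Rightarrow> nat \<Rightarrow> 'w \<Rightarrow> nat"
    and Q :: "real \<Rightarrow> 'b measure"
    and zbar :: "real \<Rightarrow> 'b \<Rightarrow> int"
    and \<Phi>_star :: "real set"
  (* the model *)
  assumes "lam_max \<ge> lam_min" "lam_min \<ge> 0" "mu_max \<ge> mu_min" "mu_min \<ge> 0" "\<sigma>_max > 0" "M > 0"
    and "lam_min < mu_star" "mu_star < lam_max" "mu_min < mu_star" "mu_star < mu_max"
    and "continuous_on UNIV \<sigma>c" "\<And>x. \<sigma>c x \<in> {0..\<sigma>_max}"
    and "continuous_on UNIV \<sigma>s" "\<And>x. \<sigma>s x \<in> {0..\<sigma>_max}"
    and "\<phi>c \<in> borel_measurable borel" "\<phi>s \<in> borel_measurable borel"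
    and "\<And>\<eta>. \<eta> > 0 \<Longrightarrow> \<epsilon> \<eta> > 0" "\<And>\<eta>. \<eta> > 0 \<Longrightarrow> \<tau> \<eta> > 0"
    and "\<And>\<eta>. \<eta> > 0 \<Longrightarrow> matching_queue (N \<eta>) (ac \<eta>) (as \<eta>)
           (controlled_rate (lam_star \<eta>) (\<epsilon> \<eta>) (\<tau> \<eta>) \<phi>c lam_max lam_min)
           (controlled_rate mu_star (\<epsilon> \<eta>) (\<tau> \<eta>) \<phi>s mu_max mu_min)
           \<sigma>c \<sigma>s M"
  (* the asymptotic regime *)
    and "(\<epsilon> \<longlongrightarrow> 0) at_top \<or> filterlim \<tau> at_top at_top"
    and "filterlim (\<lambda>\<eta>. \<epsilon> \<eta> * \<tau> \<eta>) at_top at_top"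
    and "\<And>\<eta>. \<eta> > 0 \<Longrightarrow> lam_star \<eta> = mu_star - d / \<tau> \<eta>"
  (* negative drift *)
    and "\<delta> > 0" "K > 0" "B > 0"
    and "\<And>x. x > K \<Longrightarrow> \<phi>c x - \<phi>s x < - \<delta> \<and> max (\<phi>c x) 0 + max (- \<phi>s x) 0 \<le> B"
    and "\<And>x. x < - K \<Longrightarrow> \<phi>c x - \<phi>s x > \<delta> \<and> max (- \<phi>c x) 0 + max (\<phi>s x) 0 \<le> B"
  (* sub-quadratic growth *)
    and "0 < \<beta>" "\<beta> < 2"
    and "\<And>x. \<bar>\<phi>c x\<bar> \<le> \<bar>x\<bar> powr \<beta>" "\<And>x. \<bar>\<phi>s x\<bar> \<le> \<bar>x\<bar> powr \<beta>"
  (* jumps in both directions *)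
    and "p_min > 0"
    and "\<And>\<eta> z. \<eta> > 0 \<Longrightarrow> \<bar>of_int z\<bar> \<le> K * max (\<tau> \<eta>) (1 / \<epsilon> \<eta>) \<Longrightarrow>
           \<P>(w in N \<eta>. ac \<eta> z 0 w > as \<eta> z 0 w) \<ge> p_min \<and>
           \<P>(w in N \<eta>. ac \<eta> z 0 w < as \<eta> z 0 w) \<ge> p_min"
  (* monotonicity *)
    and "antimono \<phi>c" "mono \<phi>s"
    and "\<Phi>_star = {x. \<phi>c x - \<phi>s x = 0}" "0 \<in> \<Phi>_star"
    and "\<And>x. x \<in> \<Phi>_star \<Longrightarrow> \<phi>c x = 0 \<and> \<phi>s x = 0"
  (* positive recurrence and the steady state *)
    and "\<eta>0 > 0" "\<And>\<eta>. \<eta> \<ge> \<eta>0 \<Longrightarrow> \<tau> \<eta> * \<epsilon> \<eta> \<ge> 2 * d / \<delta>" "\<eta>p > 0"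
    and "\<And>\<eta>. \<eta> \<ge> max \<eta>0 \<eta>p \<Longrightarrow>
           chain_positive_recurrent (N \<eta>) (imbalance (ac \<eta>) (as \<eta>))"
    and "\<And>\<eta>. \<eta> \<ge> max \<eta>0 \<eta>p \<Longrightarrow> prob_space (Q \<eta>) \<and> zbar \<eta> \<in> Q \<eta> \<rightarrow>\<^sub>M count_space UNIV \<and>
           stationary_distribution (N \<eta>) (imbalance (ac \<eta>) (as \<eta>))
             (distr (Q \<eta>) (count_space UNIV) (zbar \<eta>))"
    and "\<sigma>_star = \<sigma>c mu_star + \<sigma>s mu_star"
  shows "(\<Phi>_star - {0} \<noteq> {} \<and> d = 0 \<longrightarrow>
            converges_in_distribution Q (\<lambda>\<eta> w. of_int (zbar \<eta> w) / \<tau> \<eta>)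
              (uniform_measure lborel \<Phi>_star) at_top)
       \<and> (\<Phi>_star - {0} \<noteq> {} \<and> d \<noteq> 0 \<longrightarrow>
            converges_in_distribution Q (\<lambda>\<eta> w. of_int (zbar \<eta> w) / \<tau> \<eta>)
              (trunc_exp (2 * d / \<sigma>_star) \<Phi>_star) at_top)
       \<and> (\<Phi>_star = {0} \<longrightarrow>
            converges_in_distribution Q (\<lambda>\<eta> w. of_int (zbar \<eta> w) / \<tau> \<eta>)
              (return borel 0) at_top
            \<and> (\<forall>e>0. ((\<lambda>\<eta>. \<P>(w in Q \<eta>. \<bar>of_int (zbar \<eta> w)\<bar> / \<tau> \<eta> \<ge> e)) \<longlongrightarrow> 0) at_top))"
proof -
  note \<epsilon>_pos = assms(17) and \<tau>_pos = assms(18) and queue = assms(19) and lam_star = assms(22)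
    and right = assms(26) and left = assms(27) and jumps = assms(33) and mono = assms(34,35)
    and \<Phi> = assms(36) and zero_in = assms(37) and zeros = assms(38) and steady = assms(43)
  define \<phi> where "\<phi> x = \<phi>c x - \<phi>s x" for x
  define a where "a = Inf \<Phi>_star"
  define b where "b = Sup \<Phi>_star"
  have \<phi>_anti: "antimono \<phi>"
    using mono unfolding \<phi>_def monotone_on_def by (auto intro!: diff_mono)
  have far: "\<delta> \<le> \<bar>\<phi> x\<bar>" if "K < \<bar>x\<bar>" for x
    using that left[of x] right[of x] unfolding \<phi>_def by (cases "0 \<le> x") auto
  have "\<Phi>_star \<subseteq> {- K..K}"
  proof
    fix x assume "x \<in> \<Phi>_star"
    then show "x \<in> {- K..K}"
      using far[of x] \<open>\<delta> > 0\<close> \<Phi> by (force simp: \<phi>_def)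
  qed
  note interval = interval_of_zeros[OF \<phi>_anti \<Phi>[folded \<phi>_def] zero_in this, folded a_def b_def]
  have zero: "\<phi>c x = 0 \<and> \<phi>s x = 0" if "a < x" "x < b" for x
    using interval(1) zeros that by auto
  have zero0: "\<phi>c 0 = 0" "\<phi>s 0 = 0"
    using zeros[OF zero_in] by auto
  \<comment> \<open>Half of the distance to the bounds: the other half is room for the shift \<open>d / \<tau>\<close>.\<close>
  define k where "k = Min {mu_star - lam_min, lam_max - mu_star, mu_star - mu_min, mu_max - mu_star} / 2"
  have k: "0 < k" "lam_min + 2 * k \<le> mu_star" "mu_star + 2 * k \<le> lam_max"
      "mu_min + 2 * k \<le> mu_star" "mu_star + 2 * k \<le> mu_max"
    using assms(7-10) by (auto simp: k_def min_def)
  define T where "T c \<eta> = \<tau> \<eta> * min (\<epsilon> \<eta> * c / 2) k" for c \<eta>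
  define D where "D \<eta> = distr (Q \<eta>) (count_space UNIV) (zbar \<eta>)" for \<eta>
  define p where "p \<eta> = Abs_pmf (D \<eta>)" for \<eta>
  define J where "J \<eta> = matching_queue.jump_pmf (N \<eta>) (ac \<eta>) (as \<eta>)" for \<eta>
  define drop where "drop \<eta> = d / \<tau> \<eta>" for \<eta>

  have ev_pos: "\<forall>\<^sub>F \<eta> in at_top. 0 < \<eta> \<and> max \<eta>0 \<eta>p \<le> (\<eta>::real)"
    by (intro eventually_conj eventually_gt_at_top eventually_ge_at_top)
  \<comment> \<open>If \<open>\<epsilon>\<close> tends to \<open>0\<close>, the product \<open>\<epsilon> * \<tau>\<close> can diverge only if \<open>\<tau>\<close> does.\<close>
  have \<tau>_top: "filterlim \<tau> at_top at_top"
    using assms(20)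
  proof
    assume "(\<epsilon> \<longlongrightarrow> 0) at_top"
    then have "\<forall>\<^sub>F \<eta> in at_top. \<epsilon> \<eta> < 1"
      by (rule order_tendstoD(2)) simp
    then have "\<forall>\<^sub>F \<eta> in at_top. \<epsilon> \<eta> * \<tau> \<eta> \<le> \<tau> \<eta>"
      using ev_pos
    proof eventually_elim
      case (elim \<eta>)
      then show ?case using \<tau>_pos[of \<eta>] by simp
    qed
    with assms(21) show ?thesis by (rule filterlim_at_top_mono)
  qed
  have T_top: "filterlim (T c) at_top at_top" if "0 < c" for c
    unfolding filterlim_at_top
  proof
    fix R :: real
    have "\<forall>\<^sub>F \<eta> in at_top. 2 * R / c \<le> \<epsilon> \<eta> * \<tau> \<eta>" "\<forall>\<^sub>F \<eta> in at_top. R / k \<le> \<tau> \<eta>"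
      using assms(21) \<tau>_top by (simp_all add: filterlim_at_top)
    then show "\<forall>\<^sub>F \<eta> in at_top. R \<le> T c \<eta>"
    proof eventually_elim
      case (elim \<eta>)
      then have "R \<le> \<tau> \<eta> * (\<epsilon> \<eta> * c / 2)" "R \<le> \<tau> \<eta> * k"
        using that k(1) by (simp_all add: field_simps)
      then show ?case by (simp add: T_def min_def)
    qed
  qed
  have drop: "(drop \<longlongrightarrow> 0) at_top"
    unfolding drop_def
    by (rule tendsto_divide_0[OF tendsto_const]) (rule filterlim_at_top_imp_at_infinity[OF \<tau>_top])
  have ev_drop: "\<forall>\<^sub>F \<eta> in at_top. \<bar>drop \<eta>\<bar> < k"
    using tendsto_rabs[OF drop] k(1) by (intro order_tendstoD(2)) auto

  have confined: "\<forall>\<^sub>F \<eta> in at_top.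
        confined_walk (p \<eta>) (J \<eta>) (2 * M) a b K (\<tau> \<eta>) d (T c \<eta>) (2 * p_min) {x. c \<le> \<bar>\<phi> x\<bar>}
      \<and> (\<forall>z. real_of_int z / \<tau> \<eta> \<in> {a<..<b} \<or> z = 0 \<longrightarrow>
           stationary_walk.second_moment (J \<eta>) z = \<sigma>c (mu_star - drop \<eta>) + \<sigma>s mu_star + (drop \<eta>)\<^sup>2)"
    if c: "0 < c" "c \<le> \<delta>" for c
  proof -
    have "\<forall>\<^sub>F \<eta> in at_top. 2 * \<bar>d\<bar> \<le> T c \<eta>"
      using T_top[OF c(1)] by (simp add: filterlim_at_top)
    with ev_pos ev_drop show ?thesis
    proof eventually_elim
      case (elim \<eta>)
      then have \<eta>: "0 < \<eta>" "max \<eta>0 \<eta>p \<le> \<eta>" by auto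
      have st: "stationary_distribution (N \<eta>) (imbalance (ac \<eta>) (as \<eta>)) (D \<eta>)"
        using steady[OF \<eta>(2)] by (simp add: D_def)
      have q: "matching_queue (N \<eta>) (ac \<eta>) (as \<eta>)
           (controlled_rate (mu_star - drop \<eta>) (\<epsilon> \<eta>) (\<tau> \<eta>) \<phi>c lam_max lam_min)
           (controlled_rate mu_star (\<epsilon> \<eta>) (\<tau> \<eta>) \<phi>s mu_max mu_min) \<sigma>c \<sigma>s M"
        using queue[OF \<eta>(1)] by (simp add: lam_star[OF \<eta>(1)] drop_def)
      have jump: "measure (N \<eta>) {w \<in> space (N \<eta>). ac \<eta> z 0 w > as \<eta> z 0 w} \<ge> p_min"
          "measure (N \<eta>) {w \<in> space (N \<eta>). ac \<eta> z 0 w < as \<eta> z 0 w} \<ge> p_min"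
        if "\<bar>of_int z\<bar> \<le> K * \<tau> \<eta>" for z
      proof -
        have "K * \<tau> \<eta> \<le> K * max (\<tau> \<eta>) (1 / \<epsilon> \<eta>)"
          using \<open>K > 0\<close> by (intro mult_left_mono) auto
        then show "measure (N \<eta>) {w \<in> space (N \<eta>). ac \<eta> z 0 w > as \<eta> z 0 w} \<ge> p_min"
          "measure (N \<eta>) {w \<in> space (N \<eta>). ac \<eta> z 0 w < as \<eta> z 0 w} \<ge> p_min"
          using jumps[OF \<eta>(1), of z] that by auto
      qed
      have gap: "lam_min + k \<le> mu_star - drop \<eta>" "mu_star - drop \<eta> + k \<le> lam_max"
        "mu_min + k \<le> mu_star" "mu_star + k \<le> mu_max"
        using k elim(2) by linarith+
      have strong: "2 * \<bar>d\<bar> \<le> \<tau> \<eta> * min (\<epsilon> \<eta> * c / 2) k"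
        using elim(3) by (simp add: T_def)
      have far_c: "c \<le> \<bar>\<phi>c x - \<phi>s x\<bar>" if "K < \<bar>x\<bar>" for x
        using far[OF that] c by (simp add: \<phi>_def)
      note inst = matching_queue_confined[OF q st \<tau>_pos[OF \<eta>(1)] \<epsilon>_pos[OF \<eta>(1)] _ k(1) gap mono
          zero zero0 interval(5,3,4,6) far_c c(1) strong \<open>p_min > 0\<close> jump]
      show ?case
        using inst by (simp add: drop_def p_def J_def T_def \<phi>_def)
    qed
  qed
  define \<kappa> where "\<kappa> \<eta> = \<bar>\<sigma>c (mu_star - drop \<eta>) + \<sigma>s mu_star + (drop \<eta>)\<^sup>2 - \<sigma>_star\<bar>" for \<eta>
  have var: "((\<lambda>\<eta>. \<sigma>c (mu_star - drop \<eta>) + \<sigma>s mu_star + (drop \<eta>)\<^sup>2) \<longlongrightarrow> \<sigma>_star) at_top"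
  proof -
    have "((\<lambda>\<eta>. \<sigma>c (mu_star - drop \<eta>)) \<longlongrightarrow> \<sigma>c (mu_star - 0)) at_top"
      using assms(11)
      by (intro continuous_on_tendsto_compose[where s = UNIV and f = \<sigma>c] tendsto_intros drop) auto
    then have "((\<lambda>\<eta>. \<sigma>c (mu_star - drop \<eta>) + \<sigma>s mu_star + (drop \<eta>)\<^sup>2)
        \<longlongrightarrow> \<sigma>c (mu_star - 0) + \<sigma>s mu_star + 0\<^sup>2) at_top"
      by (intro tendsto_intros drop)
    then show ?thesis using assms(44) by simp
  qed
  have \<kappa>: "(\<kappa> \<longlongrightarrow> 0) at_top"
    unfolding \<kappa>_def using tendsto_rabs[OF tendsto_diff[OF var tendsto_const[of \<sigma>_star]]] by simp
  \<comment> \<open>The state \<open>0\<close> has nominal rates, so its second moment converges to \<open>\<sigma>_star\<close>; this makes the limit variance positive.\<close>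
  have "2 * p_min \<le> \<sigma>_star"
  proof (rule tendsto_lowerbound[OF var])
    show "\<forall>\<^sub>F \<eta> in at_top. 2 * p_min \<le> \<sigma>c (mu_star - drop \<eta>) + \<sigma>s mu_star + (drop \<eta>)\<^sup>2"
      using confined[OF \<open>\<delta> > 0\<close> order_refl]
    proof eventually_elim
      case (elim \<eta>)
      then show ?case
        using confined_walk.second_moment_ge[of "p \<eta>" "J \<eta>" "2 * M" a b K "\<tau> \<eta>" d "T \<delta> \<eta>" "2 * p_min" _ 0] \<open>K > 0\<close>
        by auto
    qed
  qed simp
  interpret confined_family p J "2 * M" a b K d "2 * p_min" \<delta> \<sigma>_star \<tau> \<kappa> T \<phi> at_top
  proof
    show "\<forall>\<^sub>F i in at_top. confined_walk (p i) (J i) (2 * M) a b K (\<tau> i) d (T c i) (2 * p_min) {x. c \<le> \<bar>\<phi> x\<bar>}"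
      if "0 < c" "c \<le> \<delta>" for c
      using confined[OF that] by eventually_elim auto
    show "\<forall>\<^sub>F i in at_top. \<forall>z. real_of_int z / \<tau> i \<in> {a<..<b} \<longrightarrow>
        \<bar>stationary_walk.second_moment (J i) z - \<sigma>_star\<bar> \<le> \<kappa> i"
      using confined[OF \<open>\<delta> > 0\<close> order_refl] by eventually_elim (auto simp: \<kappa>_def)
  qed (use \<tau>_top T_top \<open>\<delta> > 0\<close> interval far \<phi>_anti \<kappa> \<open>p_min > 0\<close> \<open>2 * p_min \<le> \<sigma>_star\<close> in auto)

  have law: "Prob \<eta> P = measure (Q \<eta>) {w \<in> space (Q \<eta>). P (of_int (zbar \<eta> w) / \<tau> \<eta>)}"
    if "max \<eta>0 \<eta>p \<le> \<eta>" for \<eta> P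
  proof -
    have "prob_space (Q \<eta>)" and [measurable]: "zbar \<eta> \<in> Q \<eta> \<rightarrow>\<^sub>M count_space UNIV"
      using steady[OF that] by auto
    then have "prob_space (D \<eta>)"
      unfolding D_def by (intro prob_space.prob_space_distr) auto
    then have "measure_pmf (p \<eta>) = D \<eta>"
      unfolding p_def by (rule measure_pmf_Abs_pmf) (simp add: D_def)
    then have "Prob \<eta> P = measure (distr (Q \<eta>) (count_space UNIV) (zbar \<eta>)) {z. P (real_of_int z / \<tau> \<eta>)}"
      by (simp add: D_def)
    also have "\<dots> = measure (Q \<eta>) {w \<in> space (Q \<eta>). P (of_int (zbar \<eta> w) / \<tau> \<eta>)}"
      by (subst measure_distr) (auto intro!: arg_cong[where f = "measure (Q \<eta>)"])
    finally show ?thesis .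
  qed
  have cdf_law: "cdf (distr (Q \<eta>) borel (\<lambda>w. of_int (zbar \<eta> w) / \<tau> \<eta>)) x = Prob \<eta> (\<lambda>y. y \<le> x)"
    if "max \<eta>0 \<eta>p \<le> \<eta>" for \<eta> x
  proof -
    have [measurable]: "zbar \<eta> \<in> Q \<eta> \<rightarrow>\<^sub>M count_space UNIV"
      using steady[OF that] by auto
    have [measurable]: "(\<lambda>w. of_int (zbar \<eta> w) / \<tau> \<eta>) \<in> borel_measurable (Q \<eta>)"
      by measurable
    show ?thesis
      unfolding law[OF that, of "\<lambda>y. y \<le> x"] cdf_def
      by (subst measure_distr) (auto intro!: arg_cong[where f = "measure (Q \<eta>)"])
  qed
  have cdf_tendsto: "((\<lambda>\<eta>. cdf (distr (Q \<eta>) borel (\<lambda>w. of_int (zbar \<eta> w) / \<tau> \<eta>)) x) \<longlongrightarrow> l) at_top"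
    if "((\<lambda>\<eta>. Prob \<eta> (\<lambda>y. y \<le> x)) \<longlongrightarrow> l) at_top" for x l
  proof (rule Lim_transform_eventually[OF that])
    show "\<forall>\<^sub>F \<eta> in at_top. Prob \<eta> (\<lambda>y. y \<le> x) = cdf (distr (Q \<eta>) borel (\<lambda>w. of_int (zbar \<eta> w) / \<tau> \<eta>)) x"
      using ev_pos by eventually_elim (simp add: cdf_law)
  qed

  have borel: "\<Phi>_star \<in> sets borel"
  proof -
    have "\<phi> \<in> borel_measurable borel"
      unfolding \<phi>_def using assms(15,16) by measurable
    then show ?thesis
      using measurable_sets[of \<phi> borel borel "{0}"] by (simp add: \<Phi> \<phi>_def vimage_def)
  qed
  have main: "converges_in_distribution Q (\<lambda>\<eta> w. of_int (zbar \<eta> w) / \<tau> \<eta>)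
      (trunc_exp (2 * d / \<sigma>_star) \<Phi>_star) at_top" if ne: "\<Phi>_star - {0} \<noteq> {}"
  proof -
    obtain y where "y \<in> \<Phi>_star" "y \<noteq> 0" using ne by blast
    then have "a < b" using interval(2,3,4) by force
    note te = trunc_exp_interval[OF interval(1,2) \<open>a < b\<close> borel, where l = "2 * d / \<sigma>_star"]
    have "((\<lambda>\<eta>. Prob \<eta> (\<lambda>y. y \<le> x)) \<longlongrightarrow> cdf (trunc_exp (2 * d / \<sigma>_star) \<Phi>_star) x) at_top" for x
    proof -
      consider "x \<le> a" | "a < x" "x < b" | "b \<le> x" by linarith
      then show ?thesis
      proof cases
        case 1
        then show ?thesis using cdf_below_tendsto[OF \<open>a < b\<close> 1] te(2)[OF 1] by simp
      next
        case 2
        have "((\<lambda>\<eta>. Prob \<eta> (\<lambda>y. y \<le> x)) \<longlongrightarrow>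
            exp_primitive (2 * d / \<sigma>_star) a x / exp_primitive (2 * d / \<sigma>_star) a b) at_top"
          using 2 exp_primitive_less[of a x "2 * d / \<sigma>_star" a] exp_primitive_less[of x b "2 * d / \<sigma>_star" a]
          by (intro cdf_inside_tendsto exp_primitive_derivative) auto
        then show ?thesis using te(3)[of x] 2 by simp
      next
        case 3
        then show ?thesis using cdf_above_tendsto[OF \<open>a < b\<close> 3] te(4)[OF 3] by simp
      qed
    qed
    then show ?thesis
      unfolding converges_in_distribution_def using te(1) cdf_tendsto by blast
  qed

  have point: "converges_in_distribution Q (\<lambda>\<eta> w. of_int (zbar \<eta> w) / \<tau> \<eta>) (return borel 0) at_top
        \<and> (\<forall>e>0. ((\<lambda>\<eta>. \<P>(w in Q \<eta>. \<bar>of_int (zbar \<eta> w)\<bar> / \<tau> \<eta> \<ge> e)) \<longlongrightarrow> 0) at_top)"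
    if "\<Phi>_star = {0}"
  proof -
    have ab: "a = 0" "b = 0"
      by (simp_all add: a_def b_def that)
    have tail: "((\<lambda>\<eta>. Prob \<eta> (\<lambda>x. x \<le> - e \<or> e \<le> x)) \<longlongrightarrow> 0) at_top" if "0 < e" for e
      using mass_far_tendsto[OF that] by (simp add: ab)
    have "((\<lambda>\<eta>. \<P>(w in Q \<eta>. \<bar>of_int (zbar \<eta> w)\<bar> / \<tau> \<eta> \<ge> e)) \<longlongrightarrow> 0) at_top" if "0 < e" for e
    proof (rule Lim_transform_eventually[OF tail[OF that]])
      show "\<forall>\<^sub>F \<eta> in at_top. Prob \<eta> (\<lambda>x. x \<le> - e \<or> e \<le> x)
          = \<P>(w in Q \<eta>. \<bar>of_int (zbar \<eta> w)\<bar> / \<tau> \<eta> \<ge> e)"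
        using ev_pos
      proof eventually_elim
        case (elim \<eta>)
        have "(x / \<tau> \<eta> \<le> - e \<or> e \<le> x / \<tau> \<eta>) = (e \<le> \<bar>x\<bar> / \<tau> \<eta>)" for x
          using \<tau>_pos[of \<eta>] elim by (auto simp: abs_if field_simps)
        then show ?case using law[of \<eta> "\<lambda>x. x \<le> - e \<or> e \<le> x"] elim by simp
      qed
    qed
    moreover have "((\<lambda>\<eta>. Prob \<eta> (\<lambda>y. y \<le> x)) \<longlongrightarrow> cdf (return borel 0) x) at_top"
      if "isCont (cdf (return borel 0)) x" for x
    proof -
      have "x \<noteq> 0" by (rule return_zero_continuity_point[OF that])
      then consider "x < 0" | "0 < x" by linarith
      then show ?thesis
      proof cases
        case 1
        then have "0 < - x" by simp
        have "((\<lambda>\<eta>. Prob \<eta> (\<lambda>y. y \<le> x)) \<longlongrightarrow> 0) at_top"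
          by (rule tendsto_sandwich[OF _ _ tendsto_const tail[OF \<open>0 < - x\<close>]])
             (auto intro!: always_eventually Prob_mono)
        then show ?thesis using 1 by (simp add: cdf_return_zero)
      next
        case 2
        have "((\<lambda>\<eta>. Prob \<eta> (\<lambda>y. \<not> y \<le> x)) \<longlongrightarrow> 0) at_top"
          by (rule tendsto_sandwich[OF _ _ tendsto_const tail[OF 2]])
             (auto intro!: always_eventually Prob_mono)
        from tendsto_diff[OF tendsto_const[of 1] this] show ?thesis
          using 2 by (simp only: Prob_compl[of _ "\<lambda>y. y \<le> x"]) (simp add: cdf_return_zero)
      qed
    qed
    moreover have "real_distribution (return borel (0::real))"
      by (simp add: real_distribution_def real_distribution_axioms_def prob_space_return)
    ultimately show ?thesis
      unfolding converges_in_distribution_def using cdf_tendsto by blast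
  qed
  have uniform: "uniform_measure lborel \<Phi>_star = trunc_exp (2 * d / \<sigma>_star) \<Phi>_star" if "d = 0"
    using that borel by (simp add: uniform_eq_trunc_exp)
  show ?thesis
  proof (rule conjI[OF _ conjI]; rule impI)
    assume *: "\<Phi>_star - {0} \<noteq> {} \<and> d = 0"
    show "converges_in_distribution Q (\<lambda>\<eta> w. of_int (zbar \<eta> w) / \<tau> \<eta>)
        (uniform_measure lborel \<Phi>_star) at_top"
      using main[OF conjunct1[OF *]] unfolding uniform[OF conjunct2[OF *]] .
  next
    assume "\<Phi>_star - {0} \<noteq> {} \<and> d \<noteq> 0"
    then show "converges_in_distribution Q (\<lambda>\<eta> w. of_int (zbar \<eta> w) / \<tau> \<eta>)
        (trunc_exp (2 * d / \<sigma>_star) \<Phi>_star) at_top"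
      by (intro main) (rule conjunct1)
  qed (rule point)
qed

end
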